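(* Let $U\in\mathcal C^2(\mathbb R^d)$ and $0<m\le L$ be such that for all $x,y\in\mathbb R^d$, $|\nabla U(x)-\nabla U(y)|\le L|x-y|$ and $(x-y)\cdot(\nabla U(x)-\nabla U(y))\ge m|x-y|^2$. Suppose moreover that $\gamma\ge 2\sqrt L$ and $0<\delta\le m/(33\gamma^3)$. Let $P$ be the transition operator of the OBABO chain with parameters $\delta,\gamma$ and potential $U$. Then for all $\nu,\mu\in\mathcal P_1(\mathbb R^{2d})$ and all $n\ge1$, $$\|\nu P^n-\mu P^n\|_{TV}\ \le\ \frac{K_1K_2}{\delta^{3/2}}(1-\delta\kappa)^{(n-1)/2}\,\mathcal W_1(\nu,\mu),$$ where $$K_1=\sqrt3\max\left(L^{1/2},L^{-1/2}\right),\quad \kappa=\frac{m}{3\gamma},\quad K_2=\sqrt{\frac{\delta}{2\pi(1-\eta^2)}}\max\left(2+\frac{3\delta^2L}{2},3\delta\right),\quad \eta=e^{-\delta\gamma/2}.$$ In particular, $r_*(P)\le 1-\delta\kappa/2$.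
   Context: Given a time-step $\delta>0$ and a friction $\gamma>0$, set $\eta=e^{-\delta\gamma/2}$. The OBABO chain is the time-homogeneous Markov chain on $\mathbb R^d\times\mathbb R^d$ whose transition from $(x_0,v_0)$ to $(x_1,v_1)$ is $$x_1=x_0+\delta\left(\eta v_0+\sqrt{1-\eta^2}\,G\right)-\frac{\delta^2}{2}\nabla U(x_0),$$ $$v_1=\eta^2v_0-\frac{\delta\eta}{2}\left(\nabla U(x_0)+\nabla U(x_1)\right)+\sqrt{1-\eta^2}\left(\eta G+G'\right),$$ where $G,G'$ are independent standard Gaussian vectors in $\mathbb R^d$. $P$ denotes its transition operator and $\nu P$ the law after one step from initial law $\nu$. Under the hypotheses of the claim $P$ has a unique invariant probability measure, denoted $\pi_\delta$. $\mathcal P_1(\mathbb R^{2d})$ is the set of probability measures with finite first moment, $\mathcal W_1$ is the 1-Wasserstein distance associated with the Euclidean norm, and $\|\nu-\mu\|_{TV}=\inf_{X\sim\nu,Y\sim\mu}2\,\mathbb P(X\ne Y)$. The total variation convergence rate of $P$ is $$r_*(P)=\exp\left(\sup_{z\in\mathbb R^{2d}}\limsup_{n\to+\infty}\frac{\ln\|\delta_zP^n-\pi_\delta\|_{TV}}{n}\right),$$ where $\delta_z$ is the Dirac mass at $z$. *)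

theory Defs
  imports "HOL-Probability.Probability"
begin

section \<open>Regularity and gradient of the potential\<close>

definition C2 :: "('a::real_normed_vector \<Rightarrow> real) \<Rightarrow> bool" where
  "C2 U \<longleftrightarrow> (\<exists>(U' :: 'a \<Rightarrow> 'a \<Rightarrow>\<^sub>L real) (U'' :: 'a \<Rightarrow> 'a \<Rightarrow>\<^sub>L ('a \<Rightarrow>\<^sub>L real)).
     (\<forall>x. (U has_derivative blinfun_apply (U' x)) (at x)) \<and>
     (\<forall>x. (U' has_derivative blinfun_apply (U'' x)) (at x)) \<and>
     continuous_on UNIV U'')"

definition grad :: "('a::real_inner \<Rightarrow> real) \<Rightarrow> 'a \<Rightarrow> 'a" where
  "grad U x = (THE D. GDERIV U x :> D)"

section \<open>Distances between probability measures\<close>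

definition couplings :: "'s measure \<Rightarrow> 's measure \<Rightarrow> ('s \<times> 's) measure set" where
  "couplings \<nu> \<mu> = {\<rho>. sets \<rho> = sets (\<nu> \<Otimes>\<^sub>M \<mu>) \<and> distr \<rho> \<nu> fst = \<nu> \<and> distr \<rho> \<mu> snd = \<mu>}"

text \<open>The normalisation is such that the distance between mutually singular measures is 2.\<close>

definition tv_dist :: "'s measure \<Rightarrow> 's measure \<Rightarrow> ennreal" where
  "tv_dist \<nu> \<mu> = (INF \<rho>\<in>couplings \<nu> \<mu>. 2 * emeasure \<rho> {p \<in> space \<rho>. fst p \<noteq> snd p})"

text \<open>On a product of Euclidean spaces, \<^const>\<open>dist\<close> is the Euclidean distance
  \<open>sqrt (\<bar>x - x'\<bar>\<^sup>2 + \<bar>v - v'\<bar>\<^sup>2)\<close>.\<close>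

definition wasserstein1 :: "'s::metric_space measure \<Rightarrow> 's measure \<Rightarrow> ennreal" where
  "wasserstein1 \<nu> \<mu> = (INF \<rho>\<in>couplings \<nu> \<mu>. \<integral>\<^sup>+p. ennreal (dist (fst p) (snd p)) \<partial>\<rho>)"

definition prob_measures1 :: "'s::euclidean_space measure set" where
  "prob_measures1 = {\<nu>. prob_space \<nu> \<and> sets \<nu> = sets borel \<and> integrable \<nu> norm}"

section \<open>Markov chains\<close>

text \<open>A transition operator is represented by its Markov kernel \<open>K\<close>, acting on an initial law.\<close>

definition law_after :: "('s \<Rightarrow> 's measure) \<Rightarrow> 's measure \<Rightarrow> nat \<Rightarrow> 's measure" where
  "law_after K \<nu> n = ((\<lambda>\<rho>. \<rho> \<bind> K) ^^ n) \<nu>"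

definition invariant_prob :: "('s::topological_space \<Rightarrow> 's measure) \<Rightarrow> 's measure \<Rightarrow> bool" where
  "invariant_prob K \<pi> \<longleftrightarrow> prob_space \<pi> \<and> sets \<pi> = sets borel \<and> \<pi> \<bind> K = \<pi>"

text \<open>Meaningful only for kernels with exactly one invariant probability measure.\<close>

definition invariant_law :: "('s::topological_space \<Rightarrow> 's measure) \<Rightarrow> 's measure" where
  "invariant_law K = (THE \<pi>. invariant_prob K \<pi>)"

text \<open>Logarithm and exponential with the conventions \<open>ln 0 = -\<infinity>\<close> and \<open>exp (-\<infinity>) = 0\<close>;
  note that \<^term>\<open>ln (0::real) = 0\<close>.\<close>

definition ln_ennreal :: "ennreal \<Rightarrow> ereal" where
  "ln_ennreal t = (if t = 0 then -\<infinity> else if t = \<infinity> then \<infinity> else ereal (ln (enn2real t)))"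

definition exp_ereal :: "ereal \<Rightarrow> ereal" where
  "exp_ereal t = (if t = -\<infinity> then 0 else if t = \<infinity> then \<infinity> else ereal (exp (real_of_ereal t)))"

definition tv_convergence_rate :: "('s::topological_space \<Rightarrow> 's measure) \<Rightarrow> ereal" where
  "tv_convergence_rate K =
     exp_ereal (SUP z. limsup (\<lambda>n.
       ln_ennreal (tv_dist (law_after K (return borel z) n) (invariant_law K)) / ereal (real n)))"

section \<open>The OBABO chain\<close>

definition std_gaussian :: "'a::euclidean_space measure" where
  "std_gaussian = density lborel
     (\<lambda>g. ennreal (exp (- (norm g)\<^sup>2 / 2) / sqrt (2 * pi) ^ DIM('a)))"

definition obabo_eta :: "real \<Rightarrow> real \<Rightarrow> real" where
  "obabo_eta \<delta> \<gamma> = exp (- \<delta> * \<gamma> / 2)"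

definition obabo_step ::
    "('a::euclidean_space \<Rightarrow> real) \<Rightarrow> real \<Rightarrow> real \<Rightarrow> 'a \<times> 'a \<Rightarrow> 'a \<times> 'a \<Rightarrow> 'a \<times> 'a" where
  "obabo_step U \<delta> \<gamma> = (\<lambda>(x\<^sub>0, v\<^sub>0) (g, g').
     let \<eta> = obabo_eta \<delta> \<gamma>;
         x\<^sub>1 = x\<^sub>0 + \<delta> *\<^sub>R (\<eta> *\<^sub>R v\<^sub>0 + sqrt (1 - \<eta>\<^sup>2) *\<^sub>R g) - (\<delta>\<^sup>2 / 2) *\<^sub>R grad U x\<^sub>0;
         v\<^sub>1 = \<eta>\<^sup>2 *\<^sub>R v\<^sub>0 - (\<delta> * \<eta> / 2) *\<^sub>R (grad U x\<^sub>0 + grad U x\<^sub>1)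
              + sqrt (1 - \<eta>\<^sup>2) *\<^sub>R (\<eta> *\<^sub>R g + g')
     in (x\<^sub>1, v\<^sub>1))"

definition obabo_kernel ::
    "('a::euclidean_space \<Rightarrow> real) \<Rightarrow> real \<Rightarrow> real \<Rightarrow> 'a \<times> 'a \<Rightarrow> ('a \<times> 'a) measure" where
  "obabo_kernel U \<delta> \<gamma> z = distr (std_gaussian \<Otimes>\<^sub>M std_gaussian) borel (obabo_step U \<delta> \<gamma> z)"

end

theory Submission
  imports Defs
begin

text \<open>Writing \<open>(x, v)\<close> for the difference of two chains driven by the same noise, a quadratic
  energy of \<open>x + \<beta> v\<close> and \<open>\<beta> v\<close> decreases by the factor \<open>1 - \<delta>\<kappa>\<close> in every
  step, by cocoercivity of the gradient; since \<open>x\<close> relaxes towards \<open>x + \<beta> v\<close>, it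
  decays at the same rate. For the last step the noise of one chain is translated so that the two
  chains meet, at the price of the total variation distance between a standard Gaussian and its
  translate. The sharp bound \<open>2 |h| / sqrt (2\<pi>)\<close> for this price leads to the
  constants \<open>K\<^sub>1 K\<^sub>2\<close>.\<close>

section \<open>Gradients of strongly convex functions\<close>

text \<open>The constants leave almost no room, and this shapes the argument. The rate
  \<open>\<kappa> = m / (3\<gamma>)\<close> exhausts the energy estimate as balanced here, given
  \<open>\<delta>m / (2\<gamma>) \<le> p m\<close>, and the prefactor needs
  \<open>(18 / 17)\<^sup>2 * 8 / 3 \<le> 3\<close>, whose left side is about 2.99. Pinsker's
  inequality would bound the price of a translation by \<open>|h|\<close>, a factor of about 1.25
  too much. The velocity update contains the gradient at the new position, so the energy estimate
  uses cocoercivity at both ends of the step. One step carries noise in position and velocity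
  together, of full dimension 2d, so a single translation of the noise matches both components at
  once. The rate also requires the invariant law to exist and to be unique. Existence comes from
  iterating the random maps backwards. Uniqueness comes from the total variation bound, which is
  kept truncated at 2 so that it applies to laws of which no moment is known.\<close>

lemma C2_GDERIV:
  fixes U :: "'a::euclidean_space \<Rightarrow> real"
  assumes "C2 U"
  shows "GDERIV U x :> grad U x"
proof -
  obtain U' :: "'a \<Rightarrow> 'a \<Rightarrow>\<^sub>L real" where U': "(U has_derivative blinfun_apply (U' x)) (at x)"
    using assms unfolding C2_def by blast
  define D where "D = (\<Sum>b\<in>Basis. blinfun_apply (U' x) b *\<^sub>R b)"
  have "blinfun_apply (U' x) = (\<lambda>h. h \<bullet> D)"
  proof
    fix h
    have "blinfun_apply (U' x) h = blinfun_apply (U' x) (\<Sum>b\<in>Basis. (h \<bullet> b) *\<^sub>R b)"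
      by (simp add: euclidean_representation)
    also have "\<dots> = (\<Sum>b\<in>Basis. (h \<bullet> b) * blinfun_apply (U' x) b)"
      by (simp add: blinfun.sum_right blinfun.scaleR_right)
    also have "\<dots> = h \<bullet> D"
      by (simp add: D_def inner_sum_right mult.commute)
    finally show "blinfun_apply (U' x) h = h \<bullet> D" .
  qed
  with U' have *: "GDERIV U x :> D"
    by (simp add: gderiv_def)
  moreover have "D' = D" if "GDERIV U x :> D'" for D'
  proof -
    have "(\<lambda>h. h \<bullet> D') = (\<lambda>h. h \<bullet> D)"
      using that * has_derivative_unique unfolding gderiv_def by blast
    then show ?thesis
      by (metis inner_commute vector_eq_rdot)
  qed
  ultimately show ?thesis
    unfolding grad_def by (rule theI)
qed

lemma GDERIV_line:
  assumes "\<And>x. GDERIV U x :> G x"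
  shows "((\<lambda>t. U (a + t *\<^sub>R d)) has_real_derivative d \<bullet> G (a + t *\<^sub>R d)) (at t)"
proof -
  have "((\<lambda>t. a + t *\<^sub>R d) has_derivative (\<lambda>h. h *\<^sub>R d)) (at t)"
    by (auto intro!: derivative_eq_intros)
  moreover have "(U has_derivative (\<lambda>h. h \<bullet> G (a + t *\<^sub>R d))) (at (a + t *\<^sub>R d))"
    using assms unfolding gderiv_def by blast
  ultimately have "((\<lambda>t. U (a + t *\<^sub>R d)) has_derivative (\<lambda>h. (h *\<^sub>R d) \<bullet> G (a + t *\<^sub>R d))) (at t)"
    using has_derivative_compose by blast
  then show ?thesis
    unfolding has_field_derivative_def by (simp add: mult_commute_abs)
qed

lemma gradient_monotone_lower_bound:
  assumes "\<And>x. GDERIV U x :> G x" "\<And>x y. 0 \<le> (x - y) \<bullet> (G x - G y)"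
  shows "U a + (b - a) \<bullet> G a \<le> U b"
proof -
  let ?d = "b - a"
  have "0 + (U (a + 0 *\<^sub>R ?d) - 0 * (?d \<bullet> G a)) \<le> U (a + 1 *\<^sub>R ?d) - 1 * (?d \<bullet> G a)"
    unfolding add_0
  proof (rule DERIV_nonneg_imp_nondecreasing[where f = "\<lambda>t. U (a + t *\<^sub>R ?d) - t * (?d \<bullet> G a)"], simp)
    fix t :: real assume t: "0 \<le> t" "t \<le> 1"
    have "0 \<le> ?d \<bullet> G (a + t *\<^sub>R ?d) - ?d \<bullet> G a"
    proof (cases "t = 0")
      case False
      have "0 \<le> t * (?d \<bullet> (G (a + t *\<^sub>R ?d) - G a))"
        using assms(2)[of "a + t *\<^sub>R ?d" a] by simp
      with False t show ?thesis
        by (simp add: zero_le_mult_iff inner_diff_right)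
    qed simp
    moreover have "((\<lambda>t. U (a + t *\<^sub>R ?d) - t * (?d \<bullet> G a)) has_real_derivative
        ?d \<bullet> G (a + t *\<^sub>R ?d) - ?d \<bullet> G a) (at t)"
      by (auto intro!: derivative_eq_intros GDERIV_line assms)
    ultimately show "\<exists>y. ((\<lambda>t. U (a + t *\<^sub>R ?d) - t * (?d \<bullet> G a)) has_real_derivative y) (at t) \<and> 0 \<le> y"
      by blast
  qed
  then show ?thesis by simp
qed

text \<open>The descent lemma: along the segment, \<open>U\<close> minus its tangent minus the
  quadratic term has nonpositive derivative by Cauchy-Schwarz and the Lipschitz bound.\<close>

lemma gradient_lipschitz_upper_bound:
  assumes "\<And>x. GDERIV U x :> G x" "\<And>x y. norm (G x - G y) \<le> L * norm (x - y)"
  shows "U b \<le> U a + (b - a) \<bullet> G a + L / 2 * (norm (b - a))\<^sup>2"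
proof -
  let ?d = "b - a"
  let ?f = "\<lambda>t. U (a + t *\<^sub>R ?d) - t * (?d \<bullet> G a) - L / 2 * t\<^sup>2 * (norm ?d)\<^sup>2"
  have "?f 1 \<le> ?f 0"
  proof (rule DERIV_nonpos_imp_nonincreasing[where f = ?f], simp)
    fix t :: real assume t: "0 \<le> t" "t \<le> 1"
    have "?d \<bullet> (G (a + t *\<^sub>R ?d) - G a) \<le> norm ?d * norm (G (a + t *\<^sub>R ?d) - G a)"
      by (rule norm_cauchy_schwarz)
    also have "\<dots> \<le> norm ?d * (L * norm (t *\<^sub>R ?d))"
      using assms(2)[of "a + t *\<^sub>R ?d" a] by (intro mult_left_mono) auto
    also have "\<dots> = L * t * (norm ?d)\<^sup>2"
      using t by (simp add: power2_eq_square)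
    finally have "?d \<bullet> G (a + t *\<^sub>R ?d) - ?d \<bullet> G a - L * t * (norm ?d)\<^sup>2 \<le> 0"
      by (simp add: inner_diff_right)
    moreover have "(?f has_real_derivative
        ?d \<bullet> G (a + t *\<^sub>R ?d) - ?d \<bullet> G a - L * t * (norm ?d)\<^sup>2) (at t)"
      by (auto intro!: derivative_eq_intros GDERIV_line assms)
    ultimately show "\<exists>y. (?f has_real_derivative y) (at t) \<and> y \<le> 0"
      by blast
  qed
  then show ?thesis by simp
qed

text \<open>The Baillon-Haddad inequality. The Bregman distance of \<open>U\<close> between two
  points is at least \<open>|G b - G a|\<^sup>2 / (2L)\<close>; adding the two Bregman distances of
  the pair removes the values of \<open>U\<close>.\<close>

lemma gradient_cocoercive:
  fixes G :: "'a::euclidean_space \<Rightarrow> 'a"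
  assumes G: "\<And>x. GDERIV U x :> G x"
    and mono: "\<And>x y. 0 \<le> (x - y) \<bullet> (G x - G y)"
    and lip: "\<And>x y. norm (G x - G y) \<le> L * norm (x - y)" and "0 < L"
  shows "(norm (G a - G b))\<^sup>2 \<le> L * ((a - b) \<bullet> (G a - G b))"
proof -
  have *: "U a + (b - a) \<bullet> G a + (norm (G b - G a))\<^sup>2 / (2 * L) \<le> U b" for a b
  proof -
    define D where "D = G b - G a"
    \<comment> \<open>A gradient step of length \<open>1 / L\<close> from \<open>b\<close> for the
      convex function \<open>U - \<langle>\<cdot>, G a\<rangle>\<close>. It minimises the quadratic
      upper bound at \<open>b\<close>, while convexity at \<open>a\<close> bounds the value at
      \<open>c\<close> from below.\<close>
    define c where "c = b - (1 / L) *\<^sub>R D"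
    have "U a + (c - a) \<bullet> G a \<le> U b + (c - b) \<bullet> G b + L / 2 * (norm (c - b))\<^sup>2"
      using gradient_monotone_lower_bound[OF G mono, of a c]
        gradient_lipschitz_upper_bound[OF G lip, of c b] by linarith
    moreover have "(c - a) \<bullet> G a = (b - a) \<bullet> G a - (D \<bullet> G a) / L"
      by (simp add: c_def inner_diff_left)
    moreover have "(c - b) \<bullet> G b = - (D \<bullet> G b) / L"
      by (simp add: c_def)
    moreover have "L / 2 * (norm (c - b))\<^sup>2 = (D \<bullet> D) / (2 * L)"
      using \<open>0 < L\<close> by (simp add: c_def power_divide dot_square_norm power2_eq_square)
    moreover have "(D \<bullet> G b) / L - (D \<bullet> G a) / L = (D \<bullet> D) / L"
      by (simp add: D_def inner_diff_right diff_divide_distrib)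
    moreover have "(D \<bullet> D) / L = 2 * ((D \<bullet> D) / (2 * L))"
      using \<open>0 < L\<close> by simp
    ultimately show ?thesis
      unfolding D_def[symmetric] dot_square_norm[symmetric] by linarith
  qed
  have "(norm (G a - G b))\<^sup>2 / L \<le> (a - b) \<bullet> (G a - G b)"
    using *[of a b] *[of b a] \<open>0 < L\<close>
    by (simp add: norm_minus_commute[of "G b"] inner_diff_left inner_diff_right)
  then show ?thesis
    using \<open>0 < L\<close> by (simp add: field_simps)
qed

section \<open>Contraction of the synchronous coupling\<close>

text \<open>In the application \<open>X\<close> is the position difference, \<open>w\<close> is
  \<open>\<beta>\<close> times the velocity difference and \<open>e\<close> is
  \<open>\<eta>\<^sup>2\<close>. The new position difference is \<open>y' - w'\<close>, and
  \<open>g\<^sub>1\<close> is the gradient difference there. The terms in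
  \<open>X \<bullet> g\<^sub>0\<close> and \<open>(y' - w') \<bullet> g\<^sub>1\<close> are the only
  gains from the force; they and the friction \<open>e\<^sup>2 < 1\<close> on \<open>w\<close> pay
  for all cross terms.\<close>

lemma twisted_energy_contraction:
  fixes X w g\<^sub>0 g\<^sub>1 :: "'a::real_inner" and p e L m k :: real
  defines "y \<equiv> X + w"
  defines "y' \<equiv> y - p *\<^sub>R g\<^sub>0 - (e * p) *\<^sub>R g\<^sub>1"
    and "w' \<equiv> e *\<^sub>R w - (e * p) *\<^sub>R g\<^sub>0 - (e * p) *\<^sub>R g\<^sub>1"
  assumes e: "0 < e" "e \<le> 1" and p: "0 < p" and L: "0 < L" and k: "0 \<le> k"
    and g\<^sub>0: "(norm g\<^sub>0)\<^sup>2 \<le> L * (X \<bullet> g\<^sub>0)" "m * (norm X)\<^sup>2 \<le> X \<bullet> g\<^sub>0"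
    and g\<^sub>1: "(norm g\<^sub>1)\<^sup>2 \<le> L * ((y' - w') \<bullet> g\<^sub>1)"
    and pL: "p * L \<le> 1 / 1000" and km: "12 * k \<le> 8 * p * m"
    and decay: "e\<^sup>2 + 27 / 5 * (p * L) + 7 * k \<le> 1"
  shows "(norm y')\<^sup>2 + (norm w')\<^sup>2 \<le> (1 - k) * ((norm y)\<^sup>2 + (norm w)\<^sup>2)"
proof -
  define q where "q = e * p"
  define a b c where "a = (norm g\<^sub>0)\<^sup>2 / L" and "b = (norm g\<^sub>1)\<^sup>2 / L" and "c = (norm w)\<^sup>2"
  have a: "0 \<le> a" "(norm g\<^sub>0)\<^sup>2 = L * a" and b: "0 \<le> b" "(norm g\<^sub>1)\<^sup>2 = L * b" and c: "0 \<le> c"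
    using L by (auto simp: a_def b_def c_def)
  have q: "0 < q" "q \<le> p"
    using e p by (auto simp: q_def mult_left_le_one_le)
  \<comment> \<open>The product \<open>y \<bullet> g\<^sub>1\<close> is traded for
    \<open>(y' - w') \<bullet> g\<^sub>1\<close>, the one that cocoercivity at the new position
    controls. The correction \<open>(p - q) *\<^sub>R g\<^sub>0\<close> is what leaves
    \<open>4 * q\<^sup>2\<close> in front of \<open>g\<^sub>0 \<bullet> g\<^sub>1\<close>.\<close>
  have expand: "(norm y')\<^sup>2 + (norm w')\<^sup>2 = (norm y)\<^sup>2 + e\<^sup>2 * c
      - 2 * p * (X \<bullet> g\<^sub>0) - 2 * q * ((y' - w') \<bullet> g\<^sub>1)
      - 2 * (p + e * q) * (w \<bullet> g\<^sub>0) - 4 * e * q * (w \<bullet> g\<^sub>1)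
      + (p\<^sup>2 + q\<^sup>2) * (norm g\<^sub>0)\<^sup>2 + 2 * q\<^sup>2 * (norm g\<^sub>1)\<^sup>2 + 4 * q\<^sup>2 * (g\<^sub>0 \<bullet> g\<^sub>1)"
    unfolding y'_def w'_def y_def c_def q_def power2_norm_eq_inner
    by (simp add: inner_simps inner_commute algebra_simps power2_eq_square)
  have young: "s * (u \<bullet> v) \<le> r * ((norm v)\<^sup>2 / L) + s\<^sup>2 / 4 * (L / r) * (norm u)\<^sup>2"
    if "0 < r" for u v :: 'a and s r
  proof -
    have "0 \<le> (norm ((s / 2) *\<^sub>R u - (r / L) *\<^sub>R v))\<^sup>2 * (L / r)"
      using L that by simp
    also have "\<dots> = r * ((norm v)\<^sup>2 / L) + s\<^sup>2 / 4 * (L / r) * (norm u)\<^sup>2 - s * (u \<bullet> v)"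
      using L that unfolding power2_norm_eq_inner
      by (simp add: inner_simps inner_commute field_simps power2_eq_square)
    finally show ?thesis by simp
  qed
  have X: "a \<le> X \<bullet> g\<^sub>0" and Y: "b \<le> (y' - w') \<bullet> g\<^sub>1"
    using g\<^sub>0(1) g\<^sub>1 L by (auto simp: a_def b_def field_simps)
  \<comment> \<open>The gain \<open>2 * p * (X \<bullet> g\<^sub>0)\<close> is split: 6/5 goes
    through cocoercivity and pays for gradient terms, 4/5 goes through strong monotonicity and pays
    for the decay of \<open>X\<close>.\<close>
  have "6 / 5 * (p * a) + 4 / 5 * (p * (m * (norm X)\<^sup>2)) \<le> 6 / 5 * (p * (X \<bullet> g\<^sub>0)) + 4 / 5 * (p * (X \<bullet> g\<^sub>0))"
    using X g\<^sub>0(2) p by (intro add_mono mult_left_mono) auto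
  then have t1: "- 2 * p * (X \<bullet> g\<^sub>0) \<le> - (6 / 5) * (p * a) - 4 / 5 * (p * m) * (norm X)\<^sup>2"
    by (simp add: algebra_simps)
  have "q * b \<le> q * ((y' - w') \<bullet> g\<^sub>1)"
    using Y q by simp
  then have t2: "- 2 * q * ((y' - w') \<bullet> g\<^sub>1) \<le> - 2 * (q * b)"
    by simp
  have eq: "e * q \<le> p" "e * e * q \<le> p"
    using e q by (auto intro: order_trans[OF mult_left_le_one_le] simp: mult_left_le_one_le mult_le_one)
  \<comment> \<open>Young's inequality may spend \<open>299 / 250 = 6 / 5 - 1 / 250\<close> of
    \<open>p * a\<close> here, and below \<open>499 / 250 = 2 - 1 / 250\<close> of
    \<open>q * b\<close>. The two remainders 1/250 pay for the squares of the gradients in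
    \<open>t5\<close>.\<close>
  have "(- 2 * (p + e * q)) * (w \<bullet> g\<^sub>0)
      \<le> (299 / 250 * p) * a + (- 2 * (p + e * q))\<^sup>2 / 4 * (L / (299 / 250 * p)) * c"
    unfolding a_def c_def using p by (intro young) auto
  also have "(- 2 * (p + e * q))\<^sup>2 / 4 * (L / (299 / 250 * p)) * c \<le> 1000 / 299 * (p * L) * c"
  proof (rule mult_right_mono)
    have "(p + e * q)\<^sup>2 \<le> (2 * p)\<^sup>2"
      using eq p e q by (intro power_mono) auto
    then have "(p + e * q)\<^sup>2 * L \<le> (2 * p)\<^sup>2 * L"
      using L by simp
    then show "(- 2 * (p + e * q))\<^sup>2 / 4 * (L / (299 / 250 * p)) \<le> 1000 / 299 * (p * L)"
      using p by (simp add: power_mult_distrib field_simps power2_eq_square)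
  qed (use c in simp)
  finally have t3: "- 2 * (p + e * q) * (w \<bullet> g\<^sub>0) \<le> 299 / 250 * (p * a) + 1000 / 299 * (p * L) * c"
    by simp
  have "(- 4 * e * q) * (w \<bullet> g\<^sub>1)
      \<le> (499 / 250 * q) * b + (- 4 * e * q)\<^sup>2 / 4 * (L / (499 / 250 * q)) * c"
    unfolding b_def c_def using q by (intro young) auto
  also have "(- 4 * e * q)\<^sup>2 / 4 * (L / (499 / 250 * q)) * c \<le> 1000 / 499 * (p * L) * c"
  proof (rule mult_right_mono)
    have "(e * e * q) * L \<le> p * L"
      using eq L by simp
    then show "(- 4 * e * q)\<^sup>2 / 4 * (L / (499 / 250 * q)) \<le> 1000 / 499 * (p * L)"
      using q by (simp add: field_simps power2_eq_square)
  qed (use c in simp)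
  finally have t4: "- 4 * e * q * (w \<bullet> g\<^sub>1) \<le> 499 / 250 * (q * b) + 1000 / 499 * (p * L) * c"
    by simp
  have qq: "q\<^sup>2 \<le> p\<^sup>2" "q\<^sup>2 \<le> q * p"
    using q by (auto simp: power2_eq_square intro!: mult_mono)
  have "2 * (g\<^sub>0 \<bullet> g\<^sub>1) \<le> (norm g\<^sub>0)\<^sup>2 + (norm g\<^sub>1)\<^sup>2"
    using zero_le_power2[of "norm (g\<^sub>0 - g\<^sub>1)"]
    unfolding power2_norm_eq_inner by (simp add: inner_simps inner_commute)
  then have "2 * q\<^sup>2 * (2 * (g\<^sub>0 \<bullet> g\<^sub>1)) \<le> 2 * q\<^sup>2 * (L * a + L * b)"
    unfolding a b by (intro mult_left_mono) auto
  then have "(p\<^sup>2 + q\<^sup>2) * (norm g\<^sub>0)\<^sup>2 + 2 * q\<^sup>2 * (norm g\<^sub>1)\<^sup>2 + 4 * q\<^sup>2 * (g\<^sub>0 \<bullet> g\<^sub>1)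
      \<le> (p\<^sup>2 + 3 * q\<^sup>2) * (L * a) + (4 * q\<^sup>2) * (L * b)"
    unfolding a b by (simp add: algebra_simps)
  also have "\<dots> \<le> (4 * p\<^sup>2) * (L * a) + (4 * (q * p)) * (L * b)"
    using qq a b L by (intro add_mono mult_right_mono) auto
  also have "\<dots> = (p * L) * (4 * (p * a)) + (p * L) * (4 * (q * b))"
    by (simp add: algebra_simps power2_eq_square)
  also have "\<dots> \<le> 1 / 1000 * (4 * (p * a)) + 1 / 1000 * (4 * (q * b))"
    using pL p q a b by (intro add_mono mult_right_mono) auto
  finally have t5: "(p\<^sup>2 + q\<^sup>2) * (norm g\<^sub>0)\<^sup>2 + 2 * q\<^sup>2 * (norm g\<^sub>1)\<^sup>2 + 4 * q\<^sup>2 * (g\<^sub>0 \<bullet> g\<^sub>1)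
      \<le> 1 / 250 * (p * a) + 1 / 250 * (q * b)"
    by (simp add: algebra_simps)
  \<comment> \<open>Young with weight 5. Together with the \<open>|w|\<^sup>2\<close> already in the
    energy this makes the 7 in \<open>decay\<close>, and
    \<open>6 / 5 * k \<le> 4 / 5 * (p * m)\<close> is the hypothesis \<open>km\<close>.\<close>
  have "(norm y)\<^sup>2 \<le> 6 / 5 * (norm X)\<^sup>2 + 6 * c"
  proof -
    have "0 \<le> (norm (X - 5 *\<^sub>R w))\<^sup>2" by simp
    then show ?thesis
      unfolding y_def c_def power2_norm_eq_inner by (simp add: inner_simps inner_commute)
  qed
  then have t6: "k * (norm y)\<^sup>2 \<le> k * (6 / 5 * (norm X)\<^sup>2 + 6 * c)"
    using k by (rule mult_left_mono)
  have t7: "(6 / 5 * k) * (norm X)\<^sup>2 \<le> (4 / 5 * (p * m)) * (norm X)\<^sup>2"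
    using km by (intro mult_right_mono) auto
  have "(e\<^sup>2 + (1000 / 299 + 1000 / 499) * (p * L) + 7 * k) * c \<le> 1 * c"
  proof (rule mult_right_mono)
    have "(1000 / 299 + 1000 / 499) * (p * L) \<le> 27 / 5 * (p * L)"
      using p L by (intro mult_right_mono) auto
    then show "e\<^sup>2 + (1000 / 299 + 1000 / 499) * (p * L) + 7 * k \<le> 1"
      using decay by linarith
  qed (use c in simp)
  then have t8: "e\<^sup>2 * c + 1000 / 299 * (p * L) * c + 1000 / 499 * (p * L) * c + 7 * (k * c) \<le> c"
    by (simp add: algebra_simps)
  show ?thesis
    unfolding expand c_def[symmetric]
    using t1 t2 t3 t4 t5 t6 t7 t8 by (simp add: algebra_simps)
qed

section \<open>Parameters of the chain and their size\<close>

locale obabo =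
  fixes U :: "'a::euclidean_space \<Rightarrow> real" and m L \<gamma> \<delta> :: real
  assumes C2: "C2 U"
    and m: "0 < m" and mL: "m \<le> L"
    and lipschitz: "norm (grad U x - grad U y) \<le> L * norm (x - y)"
    and strongly_monotone: "m * (norm (x - y))\<^sup>2 \<le> (x - y) \<bullet> (grad U x - grad U y)"
    and friction: "2 * sqrt L \<le> \<gamma>"
    and \<delta>: "0 < \<delta>" and step_bound: "\<delta> \<le> m / (33 * \<gamma> ^ 3)"
begin

abbreviation F :: "'a \<times> 'a \<Rightarrow> 'a \<times> 'a \<Rightarrow> 'a \<times> 'a" where "F \<equiv> obabo_step U \<delta> \<gamma>"

definition \<eta> :: real where "\<eta> = obabo_eta \<delta> \<gamma>"
definition \<sigma> :: real where "\<sigma> = sqrt (1 - \<eta>\<^sup>2)"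
definition \<beta> :: real where "\<beta> = \<delta> * \<eta> / (1 - \<eta>\<^sup>2)"
text \<open>The solution of \<open>p = \<delta>\<^sup>2 / 2 + \<eta>\<^sup>2 * p\<close>. After one
  step, \<open>x + \<beta> v\<close> carries the old gradient with weight \<open>p\<close> and the
  new one with weight \<open>\<eta>\<^sup>2 * p\<close>.\<close>

definition p :: real where "p = \<delta>\<^sup>2 / (2 * (1 - \<eta>\<^sup>2))"
definition k :: real where "k = \<delta> * (m / (3 * \<gamma>))"

lemma L: "0 < L" using m mL by simp

lemma \<gamma>: "0 < \<gamma>" "4 * L \<le> \<gamma>\<^sup>2"
proof -
  show "0 < \<gamma>" using friction L by (smt (verit) real_sqrt_gt_zero)
  have "(2 * sqrt L)\<^sup>2 \<le> \<gamma>\<^sup>2" using friction L by (intro power_mono) auto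
  then show "4 * L \<le> \<gamma>\<^sup>2" using L by (simp add: power_mult_distrib)
qed

text \<open>From \<open>m \<le> L \<le> \<gamma>\<^sup>2 / 4\<close> the step bound becomes
  \<open>\<delta>\<gamma> \<le> 1 / (33 * 4)\<close>. All later smallness is expressed through this
  one quantity.\<close>

lemma \<delta>\<gamma>: "0 < \<delta> * \<gamma>" "\<delta> * \<gamma> \<le> 1 / 132" "\<delta> * L \<le> \<delta> * \<gamma> / 4 * \<gamma>"
proof -
  show "0 < \<delta> * \<gamma>" using \<delta> \<gamma> by simp
  show "\<delta> * L \<le> \<delta> * \<gamma> / 4 * \<gamma>" using \<gamma> \<delta> by (simp add: power2_eq_square)
  have "\<delta> * \<gamma> \<le> m / (33 * \<gamma> ^ 3) * \<gamma>"
    using step_bound \<gamma> by (intro mult_right_mono) auto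
  also have "\<dots> = m / (33 * \<gamma>\<^sup>2)"
    using \<gamma> by (simp add: power3_eq_cube power2_eq_square)
  also have "\<dots> \<le> 1 / 132"
    using \<gamma> mL L by (simp add: divide_simps)
  finally show "\<delta> * \<gamma> \<le> 1 / 132" .
qed

lemma \<eta>_square: "\<eta>\<^sup>2 = exp (- (\<delta> * \<gamma>))"
  by (simp add: \<eta>_def obabo_eta_def flip: exp_of_nat_mult)

lemma \<eta>: "0 < \<eta>" "\<eta> < 1" "\<eta>\<^sup>2 < 1" "1 - \<eta>\<^sup>2 \<le> \<delta> * \<gamma>" "132 / 133 * (\<delta> * \<gamma>) \<le> 1 - \<eta>\<^sup>2"
proof -
  show "0 < \<eta>" "\<eta> < 1" using \<delta>\<gamma> by (auto simp: \<eta>_def obabo_eta_def)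
  then show "\<eta>\<^sup>2 < 1" by (simp add: power_less_one_iff)
  show "1 - \<eta>\<^sup>2 \<le> \<delta> * \<gamma>"
    using exp_ge_add_one_self[of "- (\<delta> * \<gamma>)"] by (simp add: \<eta>_square)
  \<comment> \<open>With \<open>t = \<delta>\<gamma>\<close>, the target is
    \<open>t / (1 + t) \<le> 1 - exp (- t)\<close>, and \<open>132 / 133\<close> is
    \<open>1 / (1 + 1 / 132)\<close>.\<close>
  have "(132 / 133 * (\<delta> * \<gamma>)) * (1 + \<delta> * \<gamma>) \<le> (132 / 133 * (\<delta> * \<gamma>)) * (133 / 132)"
    using \<delta>\<gamma> by (intro mult_left_mono) auto
  then have "132 / 133 * (\<delta> * \<gamma>) \<le> 1 - 1 / (1 + \<delta> * \<gamma>)"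
    using \<delta>\<gamma> by (simp add: field_simps)
  also have "\<dots> \<le> 1 - \<eta>\<^sup>2"
    using exp_ge_add_one_self[of "\<delta> * \<gamma>"] \<delta>\<gamma>
    by (simp add: \<eta>_square exp_minus inverse_eq_divide frac_le)
  finally show "132 / 133 * (\<delta> * \<gamma>) \<le> 1 - \<eta>\<^sup>2" .
qed

lemma \<sigma>: "0 < \<sigma>" "\<sigma>\<^sup>2 = 1 - \<eta>\<^sup>2"
  using \<eta> by (auto simp: \<sigma>_def)

text \<open>With \<open>u = \<delta>\<gamma> / 2\<close> one has \<open>\<eta> = exp (- u)\<close>
  and \<open>\<beta> = \<delta> / (2 sinh u)\<close>, so the upper bound is
  \<open>u \<le> sinh u\<close>.\<close>

lemma \<beta>: "0 < \<beta>" "\<beta> \<le> 1 / \<gamma>"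
proof -
  show "0 < \<beta>" using \<eta> \<delta> by (simp add: \<beta>_def)
  define u where "u = \<delta> * \<gamma> / 2"
  have "2 * u \<le> exp u - exp (- u)"
  proof -
    have "exp 0 - exp (- 0) - 2 * 0 \<le> exp u - exp (- u) - 2 * u"
    proof (rule DERIV_nonneg_imp_nondecreasing[where f = "\<lambda>u. exp u - exp (- u) - 2 * u"])
      show "0 \<le> u" using \<delta>\<gamma> by (simp add: u_def)
      fix x :: real
      have "((\<lambda>u. exp u - exp (- u) - 2 * u) has_real_derivative exp x + exp (- x) - 2) (at x)"
        by (auto intro!: derivative_eq_intros)
      moreover have "0 \<le> exp x + exp (- x) - 2"
        using exp_ge_add_one_self[of x] exp_ge_add_one_self[of "- x"] by linarith
      ultimately show "\<exists>y. ((\<lambda>u. exp u - exp (- u) - 2 * u) has_real_derivative y) (at x) \<and> 0 \<le> y"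
        by blast
    qed
    then show ?thesis by simp
  qed
  then have "2 * u * exp (- u) \<le> (exp u - exp (- u)) * exp (- u)"
    by (intro mult_right_mono) auto
  also have "\<dots> = 1 - (exp (- u))\<^sup>2"
    by (simp add: left_diff_distrib power2_eq_square flip: exp_add)
  finally have "\<delta> * \<gamma> * \<eta> \<le> 1 - \<eta>\<^sup>2"
    by (simp add: u_def \<eta>_def obabo_eta_def)
  then show "\<beta> \<le> 1 / \<gamma>"
    using \<eta> \<gamma> by (simp add: \<beta>_def field_simps)
qed

text \<open>Since \<open>1 - \<eta>\<^sup>2\<close> is close to \<open>\<delta>\<gamma>\<close>,
  \<open>p\<close> is close to \<open>\<delta> / (2\<gamma>)\<close> and lies above it. With
  \<open>L \<le> \<gamma>\<^sup>2 / 4\<close> this makes \<open>p * L\<close> about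
  \<open>\<delta>\<gamma> / 8\<close>; 63/500 is 1/8 with room for the factor 133/132.\<close>

lemma p: "0 < p" "\<delta> * m / (2 * \<gamma>) \<le> p * m" "p * L \<le> 63 / 500 * (\<delta> * \<gamma>)"
proof -
  show "0 < p" using \<delta> \<eta> by (simp add: p_def)
  have "\<delta> / (2 * \<gamma>) = \<delta>\<^sup>2 / (2 * (\<delta> * \<gamma>))"
    using \<delta> \<gamma> by (simp add: power2_eq_square)
  also have "\<dots> \<le> p"
    unfolding p_def using \<eta> \<delta> by (intro divide_left_mono) auto
  finally show "\<delta> * m / (2 * \<gamma>) \<le> p * m"
    using m mult_right_mono[of "\<delta> / (2 * \<gamma>)" p m] by simp
  have "p \<le> \<delta>\<^sup>2 / (2 * (132 / 133 * (\<delta> * \<gamma>)))"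
    unfolding p_def using \<eta> \<delta> \<delta>\<gamma> by (intro divide_left_mono) auto
  also have "\<dots> = 133 / 264 * (\<delta> / \<gamma>)"
    using \<delta> \<gamma> by (simp add: power2_eq_square)
  finally have "p * L \<le> 133 / 264 * (\<delta> / \<gamma>) * L"
    using L by (intro mult_right_mono) auto
  also have "\<dots> = 133 / 264 * (\<delta> * L / \<gamma>)"
    by simp
  also have "\<dots> \<le> 133 / 264 * (\<delta> * \<gamma> / 4)"
    using \<delta>\<gamma> \<gamma> by (intro mult_left_mono) (auto simp: divide_le_eq)
  also have "\<dots> \<le> 63 / 500 * (\<delta> * \<gamma>)"
    using \<delta>\<gamma> by simp
  finally show "p * L \<le> 63 / 500 * (\<delta> * \<gamma>)" .
qed

lemma k: "0 < k" "k \<le> \<delta> * \<gamma> / 12" "k < 1"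
proof -
  show "0 < k" using \<delta> m \<gamma> by (simp add: k_def)
  have "m \<le> \<gamma> * \<gamma> / 4" using mL \<gamma> by (simp add: power2_eq_square)
  then have "m / (3 * \<gamma>) \<le> \<gamma> / 12" using \<gamma> by (simp add: divide_le_eq)
  then have "k \<le> \<delta> * (\<gamma> / 12)" unfolding k_def using \<delta> by (intro mult_left_mono) auto
  then show "k \<le> \<delta> * \<gamma> / 12" by simp
  then show "k < 1" using \<delta>\<gamma> by linarith
qed

lemma GDERIV_U: "GDERIV U x :> grad U x"
  using C2 by (rule C2_GDERIV)

lemma monotone: "0 \<le> (x - y) \<bullet> (grad U x - grad U y)"
  using strongly_monotone[of x y] m by (smt (verit) mult_nonneg_nonneg zero_le_power2)

lemma cocoercive: "(norm (grad U x - grad U y))\<^sup>2 \<le> L * ((x - y) \<bullet> (grad U x - grad U y))"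
  by (rule gradient_cocoercive[OF GDERIV_U monotone lipschitz L])

text \<open>The combination \<open>x + \<beta> v\<close> is invariant under the noiseless free dynamics
  \<open>U = 0\<close>. The position has to be controlled separately from the twisted energy of
  \<open>x + \<beta> v\<close> and \<open>\<beta> v\<close>, since bounding it by that energy
  would cost a factor larger than the constant \<open>K\<^sub>1\<close> allows. The weight
  \<open>17 / 18\<close> is admissible because \<open>(18 / 17)\<^sup>2 * 4 / 3 \<le> 3 / 2\<close>.\<close>

definition lyap :: "'a \<times> 'a \<Rightarrow> real" where
  "lyap z = max (17 / 18 * norm (fst z))
     (sqrt ((norm (fst z + \<beta> *\<^sub>R snd z))\<^sup>2 + (norm (\<beta> *\<^sub>R snd z))\<^sup>2))"

lemma lyap_nonneg: "0 \<le> lyap z"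
  by (simp add: lyap_def le_max_iff_disj)

lemma lyap_fst: "norm (fst z) \<le> 18 / 17 * lyap z"
proof -
  have "17 / 18 * norm (fst z) \<le> lyap z" by (simp add: lyap_def)
  then show ?thesis by simp
qed

lemma lyap_energy: "(norm (fst z + \<beta> *\<^sub>R snd z))\<^sup>2 + (norm (\<beta> *\<^sub>R snd z))\<^sup>2 \<le> (lyap z)\<^sup>2"
proof -
  have "sqrt ((norm (fst z + \<beta> *\<^sub>R snd z))\<^sup>2 + (norm (\<beta> *\<^sub>R snd z))\<^sup>2) \<le> lyap z"
    by (simp add: lyap_def)
  then show ?thesis
    using lyap_nonneg real_sqrt_le_iff[of _ "(lyap z)\<^sup>2"] by (metis real_sqrt_unique)
qed

lemma lyap_twisted: "norm (fst z + \<beta> *\<^sub>R snd z) \<le> lyap z"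
  and lyap_snd: "norm (snd z) \<le> lyap z / \<beta>"
proof -
  have "(norm (fst z + \<beta> *\<^sub>R snd z))\<^sup>2 \<le> (lyap z)\<^sup>2" "(norm (\<beta> *\<^sub>R snd z))\<^sup>2 \<le> (lyap z)\<^sup>2"
    using lyap_energy[of z] by (smt (verit) zero_le_power2)+
  then have *: "norm (fst z + \<beta> *\<^sub>R snd z) \<le> lyap z" "norm (\<beta> *\<^sub>R snd z) \<le> lyap z"
    using lyap_nonneg power2_le_imp_le by blast+
  then show "norm (fst z + \<beta> *\<^sub>R snd z) \<le> lyap z" by simp
  show "norm (snd z) \<le> lyap z / \<beta>"
    using * \<beta> by (simp add: field_simps)
qed

lemma norm_le_lyap: "norm z \<le> (18 / 17 + 1 / \<beta>) * lyap z"
proof -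
  have "norm z \<le> norm (fst z) + norm (snd z)"
    by (metis norm_Pair_le prod.collapse)
  then show ?thesis
    using lyap_fst[of z] lyap_snd[of z] by (simp add: distrib_right)
qed

text \<open>The factor that, with the shift bound, has to fit into \<open>K\<^sub>1\<close>. The
  friction condition enters through
  \<open>\<beta>\<^sup>2 \<le> 1 / \<gamma>\<^sup>2 \<le> 1 / (4L)\<close>.\<close>

lemma lyap_le_norm: "lyap z \<le> sqrt (4 / 3) * max (sqrt L) (1 / sqrt L) * norm z"
proof -
  obtain x v where z: "z = (x, v)" by (cases z)
  let ?M = "max (sqrt L) (1 / sqrt L)"
  let ?w = "\<beta> *\<^sub>R v"
  have M: "1 \<le> ?M\<^sup>2" "1 / L \<le> ?M\<^sup>2" "0 \<le> ?M"
  proof -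
    have "(1 / sqrt L)\<^sup>2 \<le> ?M\<^sup>2" "(sqrt L)\<^sup>2 \<le> ?M\<^sup>2"
      using L by (intro power_mono; simp)+
    then show "1 / L \<le> ?M\<^sup>2" "1 \<le> ?M\<^sup>2"
      using L by (auto simp: power_divide) (smt (verit) le_divide_eq_1_pos)
    show "0 \<le> ?M" using L by (simp add: le_max_iff_disj)
  qed
  have "(norm ?w)\<^sup>2 \<le> (1 / \<gamma> * norm v)\<^sup>2"
    using \<beta> mult_right_mono[OF \<beta>(2), of "norm v"] by (intro power_mono) auto
  also have "\<dots> \<le> (norm v)\<^sup>2 / (4 * L)"
    using \<gamma> L by (simp add: power_divide frac_le)
  finally have w: "(norm ?w)\<^sup>2 \<le> 1 / 4 * (1 / L * (norm v)\<^sup>2)"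
    by simp
  have "0 \<le> 1 / L * (norm v)\<^sup>2"
    using L by simp
  with w have w5: "5 * (norm ?w)\<^sup>2 \<le> 4 / 3 * (1 / L * (norm v)\<^sup>2)"
    by linarith
  \<comment> \<open>Young with weight 3 gives 4/3 and 4, and the extra \<open>|b|\<^sup>2\<close>
    makes 5. Since \<open>|\<beta> v|\<^sup>2 \<le> |v|\<^sup>2 / (4L)\<close>, the velocity is
    charged 5/4, which is below 4/3.\<close>
  have "(norm (a + b))\<^sup>2 + (norm b)\<^sup>2 \<le> 4 / 3 * (norm a)\<^sup>2 + 5 * (norm b)\<^sup>2" for a b :: 'a
  proof -
    have "0 \<le> (norm (a - 3 *\<^sub>R b))\<^sup>2" by simp
    then show ?thesis
      unfolding power2_norm_eq_inner by (simp add: inner_simps inner_commute)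
  qed
  then have "(norm (x + ?w))\<^sup>2 + (norm ?w)\<^sup>2 \<le> 4 / 3 * (norm x)\<^sup>2 + 5 * (norm ?w)\<^sup>2" .
  also have "\<dots> \<le> 4 / 3 * (norm x)\<^sup>2 + 4 / 3 * (1 / L * (norm v)\<^sup>2)"
    using w5 by (intro add_left_mono)
  also have "\<dots> \<le> 4 / 3 * (?M\<^sup>2 * (norm x)\<^sup>2) + 4 / 3 * (?M\<^sup>2 * (norm v)\<^sup>2)"
  proof (intro add_mono mult_left_mono mult_right_mono)
    show "(norm x)\<^sup>2 \<le> ?M\<^sup>2 * (norm x)\<^sup>2"
      using mult_right_mono[OF M(1), of "(norm x)\<^sup>2"] by simp
  qed (use M in auto)
  also have "\<dots> = (sqrt (4 / 3) * ?M * norm z)\<^sup>2"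
    by (simp add: z norm_Pair power_mult_distrib algebra_simps)
  finally have *: "sqrt ((norm (x + ?w))\<^sup>2 + (norm ?w)\<^sup>2) \<le> sqrt (4 / 3) * ?M * norm z"
    using M by (intro real_le_lsqrt) auto
  have "17 / 18 * norm x \<le> 1 * 1 * norm z"
    using norm_fst_le[of x v] norm_ge_zero[of "(x, v)"] unfolding z by linarith
  also have "\<dots> \<le> sqrt (4 / 3) * ?M * norm z"
    using M power2_le_imp_le[of 1 ?M] by (intro mult_mono) auto
  finally show ?thesis
    using * by (simp add: lyap_def z)
qed

section \<open>One step of two chains driven by the same noise\<close>

lemma step_fst: "fst (F (x, v) (g, h)) =
    x + \<delta> *\<^sub>R (\<eta> *\<^sub>R v + \<sigma> *\<^sub>R g) - (\<delta>\<^sup>2 / 2) *\<^sub>R grad U x"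
  and step_snd: "snd (F (x, v) (g, h)) = \<eta>\<^sup>2 *\<^sub>R v
    - (\<delta> * \<eta> / 2) *\<^sub>R (grad U x + grad U (fst (F (x, v) (g, h)))) + \<sigma> *\<^sub>R (\<eta> *\<^sub>R g + h)"
  by (simp_all add: obabo_step_def \<eta>_def \<sigma>_def Let_def)

lemma step_diff:
  fixes z z' \<omega> :: "'a \<times> 'a"
  defines "X \<equiv> fst (z - z')" and "V \<equiv> snd (z - z')"
    and "X\<^sub>1 \<equiv> fst (F z \<omega> - F z' \<omega>)" and "V\<^sub>1 \<equiv> snd (F z \<omega> - F z' \<omega>)"
    and "g\<^sub>0 \<equiv> grad U (fst z) - grad U (fst z')"
    and "g\<^sub>1 \<equiv> grad U (fst (F z \<omega>)) - grad U (fst (F z' \<omega>))"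
  shows "X\<^sub>1 = X + (\<delta> * \<eta>) *\<^sub>R V - (\<delta>\<^sup>2 / 2) *\<^sub>R g\<^sub>0"
    and "V\<^sub>1 = \<eta>\<^sup>2 *\<^sub>R V - (\<delta> * \<eta> / 2) *\<^sub>R g\<^sub>0 - (\<delta> * \<eta> / 2) *\<^sub>R g\<^sub>1"
proof -
  obtain x v x' v' a b where *: "z = (x, v)" "z' = (x', v')" "\<omega> = (a, b)"
    by (metis surj_pair)
  show "X\<^sub>1 = X + (\<delta> * \<eta>) *\<^sub>R V - (\<delta>\<^sup>2 / 2) *\<^sub>R g\<^sub>0"
    by (simp add: X\<^sub>1_def X_def V_def g\<^sub>0_def * step_fst algebra_simps)
  show "V\<^sub>1 = \<eta>\<^sup>2 *\<^sub>R V - (\<delta> * \<eta> / 2) *\<^sub>R g\<^sub>0 - (\<delta> * \<eta> / 2) *\<^sub>R g\<^sub>1"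
    by (simp add: V\<^sub>1_def V_def g\<^sub>0_def g\<^sub>1_def * step_snd algebra_simps)
qed

lemma kick_nonexpansive:
  assumes "0 \<le> s" "s * L \<le> 2"
  shows "norm ((x - y) - s *\<^sub>R (grad U x - grad U y)) \<le> norm (x - y)"
proof (rule power2_le_imp_le)
  let ?g = "grad U x - grad U y"
  have "s * (s * (norm ?g)\<^sup>2) \<le> s * (s * (L * ((x - y) \<bullet> ?g)))"
    using assms cocoercive by (intro mult_left_mono) auto
  also have "\<dots> \<le> s * (2 * ((x - y) \<bullet> ?g))"
    using assms mult_right_mono[OF assms(2) monotone] by (intro mult_left_mono) (auto simp: mult.assoc)
  finally show "(norm ((x - y) - s *\<^sub>R ?g))\<^sup>2 \<le> (norm (x - y))\<^sup>2"
    unfolding power2_norm_eq_inner by (simp add: inner_simps inner_commute algebra_simps)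
qed simp

text \<open>The relaxation of \<open>x\<close> towards \<open>x + \<beta> v\<close>: the new
  position difference is the convex combination, with weights \<open>\<eta>\<^sup>2\<close> and
  \<open>1 - \<eta>\<^sup>2\<close>, of the old one after a gradient kick of size
  \<open>\<delta>\<^sup>2 / (2\<eta>\<^sup>2)\<close> and of the twisted one. The kick is
  nonexpansive by cocoercivity.\<close>

lemma step_fst_le:
  "norm (fst (F z \<omega> - F z' \<omega>))
    \<le> \<eta>\<^sup>2 * norm (fst (z - z')) + (1 - \<eta>\<^sup>2) * norm (fst (z - z') + \<beta> *\<^sub>R snd (z - z'))"
proof -
  let ?X = "fst (z - z')" and ?V = "snd (z - z')"
  let ?g = "grad U (fst z) - grad U (fst z')"
  let ?s = "\<delta>\<^sup>2 / (2 * \<eta>\<^sup>2)"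
  have "(1 - \<eta>\<^sup>2) * \<beta> = \<delta> * \<eta>" "\<eta>\<^sup>2 * ?s = \<delta>\<^sup>2 / 2"
    using \<eta> by (auto simp: \<beta>_def)
  moreover have combine: "e *\<^sub>R (X - s *\<^sub>R g) + (1 - e) *\<^sub>R (X + b *\<^sub>R V)
      = X + ((1 - e) * b) *\<^sub>R V - (e * s) *\<^sub>R g" for e s b and X V g :: 'a
    by (simp add: algebra_simps)
  ultimately have "fst (F z \<omega> - F z' \<omega>) =
      \<eta>\<^sup>2 *\<^sub>R (?X - ?s *\<^sub>R ?g) + (1 - \<eta>\<^sup>2) *\<^sub>R (?X + \<beta> *\<^sub>R ?V)"
    unfolding step_diff by (simp only: combine)
  then have "norm (fst (F z \<omega> - F z' \<omega>)) \<le>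
      norm (\<eta>\<^sup>2 *\<^sub>R (?X - ?s *\<^sub>R ?g)) + norm ((1 - \<eta>\<^sup>2) *\<^sub>R (?X + \<beta> *\<^sub>R ?V))"
    by (metis norm_triangle_ineq)
  also have "\<dots> = \<eta>\<^sup>2 * norm (?X - ?s *\<^sub>R ?g) + (1 - \<eta>\<^sup>2) * norm (?X + \<beta> *\<^sub>R ?V)"
    using \<eta> by simp
  also have "norm (?X - ?s *\<^sub>R ?g) \<le> norm ?X"
    unfolding fst_diff
  proof (rule kick_nonexpansive)
    have "\<delta> * (\<delta> * L) \<le> \<delta> * (\<delta> * \<gamma> / 4 * \<gamma>)"
      using \<delta>\<gamma> \<delta> by (intro mult_left_mono) auto
    also have "\<dots> = (\<delta> * \<gamma>) * (\<delta> * \<gamma>) / 4"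
      by simp
    also have "\<dots> \<le> (1 / 132) * (1 / 132) / 4"
      using \<delta>\<gamma> by (intro divide_right_mono mult_mono) auto
    also have "\<dots> \<le> 4 * \<eta>\<^sup>2"
      using \<eta>(4) \<delta>\<gamma>(2) by linarith
    finally show "?s * L \<le> 2"
      using \<eta> by (simp add: divide_le_eq power2_eq_square)
  qed simp
  finally show ?thesis
    using \<eta> by (simp add: mult_left_mono)
qed

text \<open>Both entries of the maximum contract. The energy does so on its own, by
  \<open>twisted_energy_contraction\<close> with \<open>e = \<eta>\<^sup>2\<close>. The position
  does so because it is pulled towards a quantity bounded by \<open>lyap\<close> with the better
  constant 1 instead of 18/17.\<close>

lemma lyap_step: "lyap (F z \<omega> - F z' \<omega>) \<le> sqrt (1 - k) * lyap (z - z')"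
proof -
  let ?X = "fst (z - z')" and ?V = "snd (z - z')"
  let ?g = "grad U (fst z) - grad U (fst z')"
  let ?g' = "grad U (fst (F z \<omega>)) - grad U (fst (F z' \<omega>))"
  let ?w = "\<beta> *\<^sub>R ?V"
  let ?D = "F z \<omega> - F z' \<omega>"
  have p\<beta>: "\<delta> * \<eta> + \<beta> * \<eta>\<^sup>2 = \<beta>" "\<delta>\<^sup>2 / 2 + \<eta>\<^sup>2 * p = p" "\<beta> * (\<delta> * \<eta> / 2) = \<eta>\<^sup>2 * p"
    using \<eta> by (auto simp: \<beta>_def p_def field_simps power2_eq_square)
  have "fst ?D + \<beta> *\<^sub>R snd ?D = ?X + (\<delta> * \<eta> + \<beta> * \<eta>\<^sup>2) *\<^sub>R ?V
      - (\<delta>\<^sup>2 / 2 + \<beta> * (\<delta> * \<eta> / 2)) *\<^sub>R ?g - (\<beta> * (\<delta> * \<eta> / 2)) *\<^sub>R ?g'"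
    unfolding step_diff by (simp add: scaleR_add_left scaleR_add_right scaleR_diff_right)
  then have y: "fst ?D + \<beta> *\<^sub>R snd ?D = (?X + ?w) - p *\<^sub>R ?g - (\<eta>\<^sup>2 * p) *\<^sub>R ?g'"
    unfolding p\<beta> by simp
  have w: "\<beta> *\<^sub>R snd ?D = \<eta>\<^sup>2 *\<^sub>R ?w - (\<eta>\<^sup>2 * p) *\<^sub>R ?g - (\<eta>\<^sup>2 * p) *\<^sub>R ?g'"
    unfolding step_diff(2) scaleR_diff_right scaleR_scaleR p\<beta> by (simp add: mult.commute)
  have diff: "(?X + ?w - p *\<^sub>R ?g - (\<eta>\<^sup>2 * p) *\<^sub>R ?g') -
      (\<eta>\<^sup>2 *\<^sub>R ?w - (\<eta>\<^sup>2 * p) *\<^sub>R ?g - (\<eta>\<^sup>2 * p) *\<^sub>R ?g') = fst ?D"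
    unfolding y[symmetric] w[symmetric] by simp
  have energy: "(norm (fst ?D + \<beta> *\<^sub>R snd ?D))\<^sup>2 + (norm (\<beta> *\<^sub>R snd ?D))\<^sup>2
      \<le> (1 - k) * ((norm (?X + ?w))\<^sup>2 + (norm ?w)\<^sup>2)"
    unfolding y unfolding w
  proof (rule twisted_energy_contraction[where L = L and m = m], unfold diff)
    show "0 < \<eta>\<^sup>2" "\<eta>\<^sup>2 \<le> 1" "0 < p" "0 < L" "0 \<le> k"
      using \<eta> p L k by auto
    show "(norm ?g)\<^sup>2 \<le> L * (?X \<bullet> ?g)" "m * (norm ?X)\<^sup>2 \<le> ?X \<bullet> ?g"
      "(norm ?g')\<^sup>2 \<le> L * (fst ?D \<bullet> ?g')"
      unfolding fst_diff by (rule cocoercive strongly_monotone)+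
    show "p * L \<le> 1 / 1000"
      using p \<delta>\<gamma> by simp
    \<comment> \<open>Here \<open>12 * k = 4 * \<delta> * m / \<gamma>\<close> equals 8 times the
      lower bound of \<open>p * m\<close>: the value of \<open>\<kappa>\<close> is used up
      completely.\<close>
    show "12 * k \<le> 8 * p * m"
      using p(2) \<gamma> by (simp add: k_def)
    have "(\<eta>\<^sup>2)\<^sup>2 \<le> (1 - 132 / 133 * (\<delta> * \<gamma>)) * (1 - 132 / 133 * (\<delta> * \<gamma>))"
      unfolding power2_eq_square[of "\<eta>\<^sup>2"] using \<eta> \<delta>\<gamma> by (intro mult_mono) auto
    \<comment> \<open>The other two terms cost at most
      \<open>27 / 5 * 63 / 500 + 7 / 12 < 1.27\<close> times \<open>\<delta>\<gamma>\<close>, so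
      there is ample room in this condition.\<close>
    also have "\<dots> \<le> 1 - 197 / 100 * (\<delta> * \<gamma>)"
    proof -
      have "(\<delta> * \<gamma>) * (\<delta> * \<gamma>) \<le> (\<delta> * \<gamma>) * (1 / 132)"
        using \<delta>\<gamma> by (intro mult_left_mono) auto
      then show ?thesis
        using \<delta>\<gamma>(1) by (simp only: left_diff_distrib right_diff_distrib)
    qed
    finally show "(\<eta>\<^sup>2)\<^sup>2 + 27 / 5 * (p * L) + 7 * k \<le> 1"
      using p(3) k(2) \<delta>\<gamma>(1) by linarith
  qed
  have "(norm (fst ?D + \<beta> *\<^sub>R snd ?D))\<^sup>2 + (norm (\<beta> *\<^sub>R snd ?D))\<^sup>2 \<le> (1 - k) * (lyap (z - z'))\<^sup>2"
    by (rule order_trans[OF energy mult_left_mono[OF lyap_energy]]) (use k in simp)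
  then have "sqrt ((norm (fst ?D + \<beta> *\<^sub>R snd ?D))\<^sup>2 + (norm (\<beta> *\<^sub>R snd ?D))\<^sup>2)
      \<le> sqrt ((1 - k) * (lyap (z - z'))\<^sup>2)"
    by simp
  also have "\<dots> = sqrt (1 - k) * lyap (z - z')"
    using lyap_nonneg by (simp add: real_sqrt_mult)
  finally have 1: "sqrt ((norm (fst ?D + \<beta> *\<^sub>R snd ?D))\<^sup>2 + (norm (\<beta> *\<^sub>R snd ?D))\<^sup>2)
      \<le> sqrt (1 - k) * lyap (z - z')" .
  have "norm (fst ?D) \<le> \<eta>\<^sup>2 * (18 / 17 * lyap (z - z')) + (1 - \<eta>\<^sup>2) * lyap (z - z')"
    by (rule order_trans[OF step_fst_le], intro add_mono mult_left_mono lyap_fst lyap_twisted)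
      (use \<eta> in auto)
  \<comment> \<open>The exact gain from the weight:
    \<open>17 / 18 * (18 / 17 * e + (1 - e)) = 1 - (1 - e) / 18\<close>.\<close>
  moreover have "17 / 18 * a \<le> (1 - (1 - e) / 18) * l" if "a \<le> e * (18 / 17 * l) + (1 - e) * l" for a e l :: real
    using that by (simp add: field_simps)
  ultimately have "17 / 18 * norm (fst ?D) \<le> (1 - (1 - \<eta>\<^sup>2) / 18) * lyap (z - z')"
    by blast
  also have "\<dots> \<le> sqrt (1 - k) * lyap (z - z')"
  proof (intro mult_right_mono lyap_nonneg real_le_rsqrt)
    \<comment> \<open>54/1000 is below \<open>132 / 133 / 18\<close>. The square then gains nearly
      \<open>0.108 * \<delta>\<gamma>\<close>, more than the \<open>\<delta>\<gamma> / 12\<close>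
      that bounds \<open>k\<close>: the weight 17/18 is far enough from 1.\<close>
    have "(1 - (1 - \<eta>\<^sup>2) / 18)\<^sup>2 \<le> (1 - 54 / 1000 * (\<delta> * \<gamma>))\<^sup>2"
      using \<eta> \<delta>\<gamma> by (intro power_mono) auto
    also have "\<dots> \<le> 1 - \<delta> * \<gamma> / 12"
    proof -
      have "(\<delta> * \<gamma>) * (\<delta> * \<gamma>) \<le> (\<delta> * \<gamma>) * (1 / 132)"
        using \<delta>\<gamma> by (intro mult_left_mono) auto
      then show ?thesis
        using \<delta>\<gamma>(1) by (simp only: power2_eq_square left_diff_distrib right_diff_distrib)
    qed
    finally show "(1 - (1 - \<eta>\<^sup>2) / 18)\<^sup>2 \<le> 1 - k"
      using k by simp
  qed
  finally show ?thesis
    using 1 by (simp add: lyap_def[of ?D])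
qed

section \<open>Making two chains meet in one step\<close>

text \<open>The displacement of the noise that makes the chain started at \<open>z'\<close> land where the
  chain started at \<open>z\<close> lands. It does not depend on the noise itself.\<close>

definition shift :: "'a \<times> 'a \<Rightarrow> 'a \<times> 'a \<Rightarrow> 'a \<times> 'a" where
  "shift z z' = (1 / (\<delta> * \<sigma>)) *\<^sub>R (fst (F z 0 - F z' 0), - \<eta> *\<^sub>R fst (z - z'))"

text \<open>The shift of \<open>g\<close> is forced by equality of the new positions. The gradients
  at the new position then agree as well, and \<open>\<eta>\<close> times the same shift already
  compensates the velocity difference and the old gradients in the velocity update. What remains for
  \<open>g'\<close> is a multiple of the old position difference.\<close>

lemma step_shift: "F z' (\<omega> + shift z z') = F z \<omega>"
proof -
  obtain x v x' v' a b where *: "z = (x, v)" "z' = (x', v')" "\<omega> = (a, b)"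
    by (metis surj_pair)
  let ?Y = "fst (F z 0 - F z' 0)"
  have ds: "\<delta> \<noteq> 0" "\<sigma> \<noteq> 0"
    using \<delta> \<sigma> by auto
  have Y: "?Y = (x - x') + (\<delta> * \<eta>) *\<^sub>R (v - v') - (\<delta>\<^sup>2 / 2) *\<^sub>R (grad U x - grad U x')"
    unfolding step_diff by (simp add: *)
  have \<omega>: "\<omega> + shift z z' = (a + (1 / (\<delta> * \<sigma>)) *\<^sub>R ?Y, b - (\<eta> / (\<delta> * \<sigma>)) *\<^sub>R (x - x'))"
    by (simp add: * shift_def)
  have fst: "fst (F z' (\<omega> + shift z z')) = fst (F z \<omega>)"
    unfolding \<omega> unfolding * step_fst unfolding *[symmetric] Y
    using ds by (simp add: scaleR_add_right scaleR_diff_right)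
  have "\<sigma> *\<^sub>R (\<eta> *\<^sub>R (a + (1 / (\<delta> * \<sigma>)) *\<^sub>R ?Y) + (b - (\<eta> / (\<delta> * \<sigma>)) *\<^sub>R (x - x')))
      = \<sigma> *\<^sub>R (\<eta> *\<^sub>R a + b) + (\<eta> / \<delta>) *\<^sub>R (?Y - (x - x'))"
    using ds by (simp add: scaleR_add_right scaleR_diff_right)
  also have "(\<eta> / \<delta>) *\<^sub>R (?Y - (x - x')) = \<eta>\<^sup>2 *\<^sub>R (v - v') - (\<delta> * \<eta> / 2) *\<^sub>R (grad U x - grad U x')"
    unfolding Y using ds by (simp add: scaleR_diff_right power2_eq_square mult.commute)
  finally have "snd (F z' (\<omega> + shift z z')) = snd (F z \<omega>)"
    using fst unfolding \<omega> unfolding * step_snd unfolding *[symmetric]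
    by (simp add: algebra_simps)
  with fst show ?thesis
    by (rule prod_eqI)
qed

text \<open>Up to the factor \<open>1 / (\<delta>\<sigma>)\<close> the components are the new
  position difference and \<open>\<eta>\<close> times the old one, hence \<open>sqrt 2\<close> times
  a bound for positions. This is where the separate control of the position pays: the energy alone
  bounds \<open>|x|\<close> only with the factor \<open>sqrt 2\<close> in place of 18/17.\<close>

lemma norm_shift_le: "norm (shift z z') \<le> sqrt 2 * (18 / 17) / (\<delta> * \<sigma>) * lyap (z - z')"
proof -
  let ?l = "18 / 17 * lyap (z - z')"
  have "norm (fst (F z 0 - F z' 0)) \<le> \<eta>\<^sup>2 * ?l + (1 - \<eta>\<^sup>2) * ?l"
    (is "_ \<le> ?r")
  proof (rule order_trans[OF step_fst_le], intro add_mono mult_left_mono lyap_fst)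
    show "norm (fst (z - z') + \<beta> *\<^sub>R snd (z - z')) \<le> ?l"
      using lyap_twisted[of "z - z'"] lyap_nonneg[of "z - z'"] by linarith
  qed (use \<eta> in auto)
  also have "?r = ?l"
    by (simp only: left_diff_distrib mult_1)
  finally have 1: "norm (fst (F z 0 - F z' 0)) \<le> ?l" .
  have "norm (- \<eta> *\<^sub>R fst (z - z')) = \<eta> * norm (fst (z - z'))"
    using \<eta> by simp
  also have "\<dots> \<le> ?l"
    using mult_mono[of \<eta> 1, OF _ lyap_fst[of "z - z'"]] \<eta> by simp
  finally have 2: "norm (- \<eta> *\<^sub>R fst (z - z')) \<le> ?l" .
  have "norm (shift z z')
      = 1 / (\<delta> * \<sigma>) * sqrt ((norm (fst (F z 0 - F z' 0)))\<^sup>2 + (norm (- \<eta> *\<^sub>R fst (z - z')))\<^sup>2)"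
    using \<delta> \<sigma> unfolding shift_def norm_scaleR norm_Pair by simp
  also have "\<dots> \<le> 1 / (\<delta> * \<sigma>) * sqrt (?l\<^sup>2 + ?l\<^sup>2)"
    using \<delta> \<sigma> by (intro mult_left_mono real_sqrt_le_mono add_mono power_mono 1 2) auto
  also have "sqrt (?l\<^sup>2 + ?l\<^sup>2) = sqrt 2 * ?l"
    using lyap_nonneg[of "z - z'"] by (simp add: real_sqrt_mult flip: mult_2)
  finally show ?thesis by simp
qed

end

section \<open>The standard Gaussian measure\<close>

definition std_gaussian_density :: "'a::euclidean_space \<Rightarrow> real" where
  "std_gaussian_density g = exp (- (norm g)\<^sup>2 / 2) / sqrt (2 * pi) ^ DIM('a)"

lemma std_gaussian_density_nonneg: "0 \<le> std_gaussian_density g"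
  by (simp add: std_gaussian_density_def)

lemma borel_measurable_std_gaussian_density [measurable]:
  "std_gaussian_density \<in> borel_measurable borel"
  unfolding std_gaussian_density_def by measurable

lemma std_gaussian_eq: "std_gaussian = density lborel (\<lambda>g. ennreal (std_gaussian_density g))"
  by (simp add: std_gaussian_def std_gaussian_density_def)

lemma sets_std_gaussian [simp, measurable_cong]: "sets std_gaussian = sets borel"
  by (simp add: std_gaussian_def)

lemma space_std_gaussian [simp]: "space std_gaussian = UNIV"
  by (simp add: std_gaussian_def)

lemma std_gaussian_density_prod:
  "std_gaussian_density g = (\<Prod>b\<in>Basis. std_normal_density (g \<bullet> b))"
proof -
  have "(norm g)\<^sup>2 = (\<Sum>b\<in>Basis. (g \<bullet> b)\<^sup>2)"
    by (subst power2_norm_eq_inner, subst euclidean_inner) (simp add: power2_eq_square)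
  then show ?thesis
    by (simp add: std_gaussian_density_def std_normal_density_def prod.distrib prod_dividef
        sum_negf sum_divide_distrib power_one_over flip: exp_sum)
qed

text \<open>Boxes determine everything needed later: the total mass, the laws of the coordinates and
  their independence.\<close>

lemma emeasure_std_gaussian_box:
  assumes [measurable]: "\<And>b. b \<in> Basis \<Longrightarrow> A b \<in> sets borel"
  shows "emeasure (std_gaussian :: 'a::euclidean_space measure) {g. \<forall>b\<in>Basis. g \<bullet> b \<in> A b}
    = (\<Prod>b\<in>Basis. emeasure (density lborel std_normal_density) (A b))"
proof -
  have [measurable]: "{g::'a. \<forall>b\<in>Basis. g \<bullet> b \<in> A b} \<in> sets borel"
  proof -
    have "{g::'a. \<forall>b\<in>Basis. g \<bullet> b \<in> A b} = (\<Inter>b\<in>Basis. (\<lambda>g. g \<bullet> b) -` A b)"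
      by auto
    moreover have "(\<lambda>g. g \<bullet> b) -` A b \<in> sets borel" if "b \<in> Basis" for b :: 'a
      using measurable_sets[of "\<lambda>g. g \<bullet> b" borel borel "A b"] that by simp
    ultimately show ?thesis
      by (auto intro!: sets.finite_INT)
  qed
  have "emeasure std_gaussian {g::'a. \<forall>b\<in>Basis. g \<bullet> b \<in> A b}
      = (\<integral>\<^sup>+g. ennreal (std_gaussian_density g) * indicator {g::'a. \<forall>b\<in>Basis. g \<bullet> b \<in> A b} g \<partial>lborel)"
    by (simp add: std_gaussian_eq emeasure_density)
  also have "\<dots> = (\<integral>\<^sup>+g. ennreal (\<Prod>b\<in>Basis. std_normal_density (g \<bullet> b) * indicator (A b) (g \<bullet> b)) \<partial>lborel)"
  proof (intro nn_integral_cong)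
    fix g :: 'a
    show "ennreal (std_gaussian_density g) * indicator {g. \<forall>b\<in>Basis. g \<bullet> b \<in> A b} g
        = ennreal (\<Prod>b\<in>Basis. std_normal_density (g \<bullet> b) * indicator (A b) (g \<bullet> b))"
    proof (cases "\<forall>b\<in>Basis. g \<bullet> b \<in> A b")
      case False
      then have *: "(\<Prod>b\<in>Basis. std_normal_density (g \<bullet> b) * indicator (A b) (g \<bullet> b)) = (0::real)"
        by (intro prod_zero) (auto simp: indicator_def)
      show ?thesis
        unfolding * using False by simp
    qed (simp add: std_gaussian_density_prod)
  qed
  also have "\<dots> = (\<integral>\<^sup>+g. (\<Prod>b\<in>Basis. ennreal (std_normal_density (g \<bullet> b) * indicator (A b) (g \<bullet> b))) \<partial>lborel)"
    by (simp add: prod_ennreal)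
  also have "\<dots> = (\<Prod>b\<in>Basis. \<integral>\<^sup>+x. ennreal (std_normal_density x * indicator (A b) x) \<partial>lborel)"
    by (subst nn_integral_lborel_prod) auto
  also have "\<dots> = (\<Prod>b\<in>Basis. emeasure (density lborel std_normal_density) (A b))"
    by (intro prod.cong) (auto simp: emeasure_density ennreal_mult' ennreal_indicator)
  finally show ?thesis .
qed

lemma prob_space_std_gaussian: "prob_space (std_gaussian :: 'a::euclidean_space measure)"
proof
  have "emeasure (density lborel std_normal_density) UNIV = 1"
    using prob_space.emeasure_space_1[OF prob_space_normal_density[of 1 0]] by simp
  then show "emeasure (std_gaussian :: 'a measure) (space std_gaussian) = 1"
    using emeasure_std_gaussian_box[where 'a = 'a and A = "\<lambda>_. UNIV"] by simp
qed

lemma distributed_std_gaussian_Basis: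
  assumes "b \<in> Basis"
  shows "distributed std_gaussian lborel (\<lambda>g. g \<bullet> b) std_normal_density"
  unfolding distributed_def
proof (intro conjI)
  show "distr std_gaussian lborel (\<lambda>g. g \<bullet> b) = density lborel std_normal_density"
  proof (rule measure_eqI)
    fix A assume "A \<in> sets (distr std_gaussian lborel (\<lambda>g. g \<bullet> b))"
    then have A: "A \<in> sets borel" by simp
    let ?A = "\<lambda>b'. if b' = b then A else UNIV"
    have 1: "emeasure (density lborel std_normal_density) UNIV = 1"
      using prob_space.emeasure_space_1[OF prob_space_normal_density[of 1 0]] by simp
    have "emeasure (distr std_gaussian lborel (\<lambda>g. g \<bullet> b)) A = emeasure std_gaussian ((\<lambda>g. g \<bullet> b) -` A)"
      using A by (subst emeasure_distr) auto
    also have "(\<lambda>g. g \<bullet> b) -` A = {g. \<forall>b'\<in>Basis. g \<bullet> b' \<in> ?A b'}"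
      using assms by auto
    also have "emeasure std_gaussian \<dots> = (\<Prod>b'\<in>Basis. emeasure (density lborel std_normal_density) (?A b'))"
      using A by (intro emeasure_std_gaussian_box) auto
    also have "\<dots> = (\<Prod>b'\<in>Basis. if b' = b then emeasure (density lborel std_normal_density) A else 1)"
      by (intro prod.cong) (auto simp: 1)
    also have "\<dots> = emeasure (density lborel std_normal_density) A"
      using assms by (simp add: prod.delta)
    finally show "emeasure (distr std_gaussian lborel (\<lambda>g. g \<bullet> b)) A
      = emeasure (density lborel std_normal_density) A" .
  qed simp
qed auto

lemma indep_vars_std_gaussian_Basis:
  "prob_space.indep_vars std_gaussian (\<lambda>_. borel) (\<lambda>b g. g \<bullet> b) (Basis :: 'a::euclidean_space set)"
proof -
  interpret G: prob_space "std_gaussian :: 'a measure" by (rule prob_space_std_gaussian)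
  let ?N = "density lborel std_normal_density"
  interpret N: prob_space ?N by (rule prob_space_normal_density) simp
  interpret product_sigma_finite "\<lambda>b::'a. ?N" ..
  have N: "distr std_gaussian borel (\<lambda>g. g \<bullet> b) = ?N" if "b \<in> Basis" for b :: 'a
    using distributed_std_gaussian_Basis[OF that]
    by (simp add: distributed_def cong: distr_cong)
  have "distr std_gaussian (\<Pi>\<^sub>M b\<in>Basis. borel) (\<lambda>g. \<lambda>b\<in>Basis. g \<bullet> b) = (\<Pi>\<^sub>M b\<in>(Basis::'a set). ?N)"
  proof (rule PiM_eqI)
    fix A assume A: "\<And>b::'a. b \<in> Basis \<Longrightarrow> A b \<in> sets ?N"
    then have "emeasure (distr std_gaussian (\<Pi>\<^sub>M b\<in>Basis. borel) (\<lambda>g. \<lambda>b\<in>Basis. g \<bullet> b)) (Pi\<^sub>E Basis A)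
      = emeasure std_gaussian ((\<lambda>g::'a. \<lambda>b\<in>Basis. g \<bullet> b) -` Pi\<^sub>E Basis A)"
      by (subst emeasure_distr) (auto intro!: sets_PiM_I_finite)
    also have "(\<lambda>g::'a. \<lambda>b\<in>Basis. g \<bullet> b) -` Pi\<^sub>E Basis A = {g. \<forall>b\<in>Basis. g \<bullet> b \<in> A b}"
      by (auto simp: PiE_iff)
    also have "emeasure std_gaussian \<dots> = (\<Prod>b\<in>Basis. emeasure ?N (A b))"
      using A by (intro emeasure_std_gaussian_box) auto
    finally show "emeasure (distr std_gaussian (\<Pi>\<^sub>M b\<in>Basis. borel) (\<lambda>g. \<lambda>b\<in>Basis. g \<bullet> b)) (Pi\<^sub>E Basis A)
      = (\<Prod>b\<in>Basis. emeasure ?N (A b))" .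
  qed (auto intro!: sets_PiM_cong)
  also have "\<dots> = (\<Pi>\<^sub>M b\<in>Basis. distr std_gaussian borel (\<lambda>g. g \<bullet> b))"
    by (intro PiM_cong) (simp_all add: N)
  finally show ?thesis
    by (subst G.indep_vars_iff_distr_eq_PiM) auto
qed

lemma distributed_std_gaussian_inner:
  fixes h :: "'a::euclidean_space"
  assumes "h \<noteq> 0"
  shows "distributed std_gaussian lborel (\<lambda>g. g \<bullet> h) (normal_density 0 (norm h))"
proof -
  interpret G: prob_space "std_gaussian :: 'a measure" by (rule prob_space_std_gaussian)
  \<comment> \<open>Only the coordinates with nonzero coefficient are summed, since a normal law in
    \<open>sum_indep_normal\<close> must have positive deviation.\<close>
  let ?I = "{b\<in>Basis. h \<bullet> b \<noteq> 0}"
  have I: "?I \<noteq> {}" using assms euclidean_eq_iff[of h 0] by auto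
  have "distributed std_gaussian lborel (\<lambda>g. \<Sum>b\<in>?I. (h \<bullet> b) * (g \<bullet> b))
      (normal_density (\<Sum>b\<in>?I. 0) (sqrt (\<Sum>b\<in>?I. \<bar>h \<bullet> b\<bar>\<^sup>2)))"
  proof (rule G.sum_indep_normal)
    show "G.indep_vars (\<lambda>_. borel) (\<lambda>b g. (h \<bullet> b) * (g \<bullet> b)) ?I"
      by (rule G.indep_vars_compose2[where M' = "\<lambda>_. borel"],
          rule G.indep_vars_subset[OF indep_vars_std_gaussian_Basis]) auto
    fix b assume "b \<in> ?I"
    then show "distributed std_gaussian lborel (\<lambda>g. (h \<bullet> b) * (g \<bullet> b)) (normal_density 0 \<bar>h \<bullet> b\<bar>)"
      using G.normal_density_affine[OF distributed_std_gaussian_Basis, of b "h \<bullet> b" 0] by simp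
  qed (use I in auto)
  moreover have inner: "(\<Sum>b\<in>?I. (h \<bullet> b) * (g \<bullet> b)) = g \<bullet> h" for g
  proof -
    have "(\<Sum>b\<in>?I. (h \<bullet> b) * (g \<bullet> b)) = (\<Sum>b\<in>Basis. (h \<bullet> b) * (g \<bullet> b))"
      by (rule sum.mono_neutral_left) auto
    then show ?thesis
      by (simp add: euclidean_inner[of h g] inner_commute[of g h])
  qed
  moreover have "(\<Sum>b\<in>?I. \<bar>h \<bullet> b\<bar>\<^sup>2) = (norm h)\<^sup>2"
    using inner[of h] by (simp add: power2_eq_square dot_square_norm)
  ultimately show ?thesis by simp
qed

text \<open>Lets the two noises of a step be treated as one Gaussian vector on the product space, so
  that a single translation moves both.\<close>

lemma std_gaussian_pair:
  "std_gaussian \<Otimes>\<^sub>M std_gaussian = (std_gaussian :: ('a::euclidean_space \<times> 'b::euclidean_space) measure)"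
proof -
  interpret prob_space "std_gaussian :: 'b measure" by (rule prob_space_std_gaussian)
  have "sigma_finite_measure (density lborel (\<lambda>g::'b. ennreal (std_gaussian_density g)))"
    unfolding std_gaussian_eq[symmetric] by unfold_locales
  then have "std_gaussian \<Otimes>\<^sub>M std_gaussian = density (lborel \<Otimes>\<^sub>M lborel)
      (\<lambda>(x::'a, y::'b). ennreal (std_gaussian_density x) * ennreal (std_gaussian_density y))"
    unfolding std_gaussian_eq by (intro pair_measure_density) (auto intro: sigma_finite_lborel)
  also have "(\<lambda>(x::'a, y::'b). ennreal (std_gaussian_density x) * ennreal (std_gaussian_density y))
      = (\<lambda>g. ennreal (std_gaussian_density g))"
  proof (rule ext, clarify)
    fix x :: 'a and y :: 'b
    have "exp (- (norm (x, y))\<^sup>2 / 2) = exp (- (norm x)\<^sup>2 / 2) * exp (- (norm y)\<^sup>2 / 2)"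
      by (simp add: norm_Pair field_simps flip: exp_add)
    then show "ennreal (std_gaussian_density x) * ennreal (std_gaussian_density y)
        = ennreal (std_gaussian_density (x, y))"
      by (simp add: std_gaussian_density_def power_add flip: ennreal_mult)
  qed
  finally show ?thesis
    by (simp add: lborel_prod std_gaussian_eq)
qed

lemma nn_integral_std_gaussian_norm:
  "(\<integral>\<^sup>+g. ennreal (norm g) \<partial>(std_gaussian :: 'a::euclidean_space measure)) < \<infinity>"
proof -
  have "(\<integral>\<^sup>+g. ennreal (norm g) \<partial>(std_gaussian :: 'a measure))
      \<le> (\<integral>\<^sup>+g. (\<Sum>b\<in>Basis. ennreal \<bar>g \<bullet> b\<bar>) \<partial>(std_gaussian :: 'a measure))"
    by (intro nn_integral_mono) (auto simp: ennreal_leI[OF norm_le_l1])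
  also have "\<dots> = (\<Sum>b\<in>Basis. \<integral>\<^sup>+g. ennreal \<bar>g \<bullet> b\<bar> \<partial>(std_gaussian :: 'a measure))"
    by (intro nn_integral_sum) auto
  also have "\<dots> < \<infinity>"
  proof (clarsimp simp: less_top[symmetric])
    fix b :: 'a assume b: "b \<in> Basis"
    assume top: "(\<integral>\<^sup>+g. ennreal \<bar>g \<bullet> b\<bar> \<partial>std_gaussian) = \<top>"
    have "(\<integral>\<^sup>+g. ennreal \<bar>g \<bullet> b\<bar> \<partial>std_gaussian)
      = (\<integral>\<^sup>+x. ennreal (std_normal_density x) * ennreal \<bar>x\<bar> \<partial>lborel)"
      by (subst distributed_nn_integral[OF distributed_std_gaussian_Basis[OF b]]) auto
    also have "\<dots> = (\<integral>\<^sup>+x. ennreal (std_normal_density x * \<bar>x\<bar> ^ 1) \<partial>lborel)"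
      by (simp add: ennreal_mult')
    also have "\<dots> < \<infinity>"
      using integrable_std_normal_moment_abs[of 1]
      by (auto simp: integrable_iff_bounded abs_mult)
    finally show False using top by simp
  qed
  finally show ?thesis .
qed

section \<open>Coupling a Gaussian vector with its translates\<close>

lemma nn_integral_lborel_translate:
  fixes h :: "'a::euclidean_space"
  assumes [measurable]: "f \<in> borel_measurable borel"
  shows "(\<integral>\<^sup>+x. f (x + h) \<partial>lborel) = (\<integral>\<^sup>+x. f x \<partial>lborel)"
proof -
  have "(\<integral>\<^sup>+x. f x \<partial>lborel) = (\<integral>\<^sup>+x. f x \<partial>distr lborel borel ((+) h))"
    by (simp only: lborel_distr_plus)
  also have "\<dots> = (\<integral>\<^sup>+x. f (x + h) \<partial>lborel)"
    by (subst nn_integral_distr) (auto simp: add.commute)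
  finally show ?thesis by simp
qed

lemma nn_integral_lborel_uminus:
  fixes f :: "'a::euclidean_space \<Rightarrow> ennreal"
  assumes [measurable]: "f \<in> borel_measurable borel"
  shows "(\<integral>\<^sup>+x. f (- x) \<partial>lborel) = (\<integral>\<^sup>+x. f x \<partial>lborel)"
proof -
  have "(\<integral>\<^sup>+x. f x \<partial>lborel) = (\<integral>\<^sup>+x. f x \<partial>distr lborel borel (\<lambda>x::'a. 0 + (- 1) *\<^sub>R x))"
    using lborel_affine[of "- 1" "0::'a"] by (simp add: density_1)
  also have "\<dots> = (\<integral>\<^sup>+x. f (- x) \<partial>lborel)"
    by (subst nn_integral_distr) auto
  finally show ?thesis by simp
qed

abbreviation uniform01 :: "real measure" where "uniform01 \<equiv> uniform_measure lborel {0..1}"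

lemma prob_space_uniform01: "prob_space uniform01"
  by (rule prob_space_uniform_measure) auto

lemma nn_integral_uniform01_if:
  assumes "0 \<le> a" "a \<le> 1"
  shows "(\<integral>\<^sup>+u. (if u \<le> a then x else y) \<partial>uniform01) = ennreal a * x + ennreal (1 - a) * y"
proof -
  have "(\<integral>\<^sup>+u. (if u \<le> a then x else y) \<partial>uniform01)
      = (\<integral>\<^sup>+u. (x * indicator {..a} u + y * indicator {a<..} u) \<partial>uniform01)"
    by (intro nn_integral_cong) (auto simp: indicator_def)
  also have "\<dots> = x * emeasure uniform01 {..a} + y * emeasure uniform01 {a<..}"
    by (subst nn_integral_add) (auto simp: nn_integral_cmult_indicator)
  also have "emeasure uniform01 {..a} = ennreal a"
  proof -
    have "{0..1} \<inter> {..a} = {0..a}" using assms by auto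
    then show ?thesis using assms divide_ennreal[of a 1] by simp
  qed
  also have "emeasure uniform01 {a<..} = ennreal (1 - a)"
  proof -
    have "{0..1} \<inter> {a<..} = {a<..1}" using assms by auto
    then show ?thesis using assms divide_ennreal[of "1 - a" 1] by simp
  qed
  finally show ?thesis by (simp add: mult.commute)
qed

text \<open>The Metropolis ratio \<open>f (g + h) / f g\<close> of the Gaussian density
  \<open>f\<close>, capped at 1.\<close>

definition accept :: "'a::euclidean_space \<Rightarrow> 'a \<Rightarrow> real" where
  "accept h g = min 1 (exp (- (g \<bullet> h + (norm h)\<^sup>2 / 2)))"

text \<open>A coupling that translates whenever possible has to draw from the residual law upon
  rejection. Because the Gaussian density is even, \<open>- g\<close> already has that law, so the
  second noise is an explicit function of the first one and a uniform variable.\<close>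

definition translate_or_reflect :: "'a::euclidean_space \<Rightarrow> 'a \<times> real \<Rightarrow> 'a" where
  "translate_or_reflect h = (\<lambda>(g, u). if u \<le> accept h g then g + h else - g)"

lemma accept: "0 \<le> accept h g" "accept h g \<le> 1"
  by (auto simp: accept_def)

lemma measurable_accept [measurable]:
  assumes [measurable]: "f \<in> borel_measurable M" "g \<in> borel_measurable M"
  shows "(\<lambda>x. accept (f x) (g x)) \<in> borel_measurable M"
  unfolding accept_def by measurable

lemma std_gaussian_density_translate:
  "std_gaussian_density (g + h) = std_gaussian_density g * exp (- (g \<bullet> h + (norm h)\<^sup>2 / 2))"
proof -
  have "(norm (g + h))\<^sup>2 = (norm g)\<^sup>2 + 2 * (g \<bullet> h) + (norm h)\<^sup>2"
    unfolding power2_norm_eq_inner by (simp add: inner_simps inner_commute)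
  then have "- (norm (g + h))\<^sup>2 / 2 = - (norm g)\<^sup>2 / 2 + - (g \<bullet> h + (norm h)\<^sup>2 / 2)"
    by (simp add: field_simps)
  then show ?thesis
    unfolding std_gaussian_density_def by (simp only: exp_add times_divide_eq_left)
qed

lemma density_times_accept:
  "std_gaussian_density g * accept h g = min (std_gaussian_density g) (std_gaussian_density (g + h))"
  using std_gaussian_density_nonneg[of g]
  by (simp add: accept_def std_gaussian_density_translate min_mult_distrib_left)

text \<open>With \<open>f\<close> the Gaussian density, the accepted translates have density
  \<open>min (f g) (f (g - h))\<close> at \<open>g\<close>, and since \<open>f\<close> is even the
  reflected points contribute exactly the missing part of \<open>f g\<close>.\<close>

lemma nn_integral_translate_or_reflect:
  fixes h :: "'a::euclidean_space"
  assumes [measurable]: "\<phi> \<in> borel_measurable borel"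
  shows "(\<integral>\<^sup>+g. (\<integral>\<^sup>+u. \<phi> (translate_or_reflect h (g, u)) \<partial>uniform01) \<partial>std_gaussian)
    = (\<integral>\<^sup>+g. \<phi> g \<partial>std_gaussian)"
proof -
  let ?f = "std_gaussian_density :: 'a \<Rightarrow> real"
  let ?k = "\<lambda>g. min (?f g) (?f (g + h))"
  have "(\<integral>\<^sup>+g. (\<integral>\<^sup>+u. \<phi> (translate_or_reflect h (g, u)) \<partial>uniform01) \<partial>std_gaussian)
      = (\<integral>\<^sup>+g. ennreal (accept h g) * \<phi> (g + h) + ennreal (1 - accept h g) * \<phi> (- g) \<partial>std_gaussian)"
    by (simp add: translate_or_reflect_def if_distrib nn_integral_uniform01_if accept
        cong: if_cong)
  also have "\<dots> = (\<integral>\<^sup>+g. ennreal (?f g) *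
      (ennreal (accept h g) * \<phi> (g + h) + ennreal (1 - accept h g) * \<phi> (- g)) \<partial>lborel)"
    unfolding std_gaussian_eq by (subst nn_integral_density) auto
  also have "\<dots> = (\<integral>\<^sup>+g. ennreal (?k g) * \<phi> (g + h) + ennreal (?f g - ?k g) * \<phi> (- g) \<partial>lborel)"
  proof (intro nn_integral_cong)
    fix g :: 'a
    have "?f g * (1 - accept h g) = ?f g - ?k g"
      by (simp only: right_diff_distrib density_times_accept mult_1_right)
    moreover have "ennreal (?f g) * (ennreal (accept h g) * x + ennreal (1 - accept h g) * y)
        = ennreal (?f g * accept h g) * x + ennreal (?f g * (1 - accept h g)) * y" for x y
      using accept[of h g] std_gaussian_density_nonneg[of g]
      by (simp add: distrib_left mult.assoc ennreal_mult)
    ultimately show "ennreal (?f g) * (ennreal (accept h g) * \<phi> (g + h) + ennreal (1 - accept h g) * \<phi> (- g))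
        = ennreal (?k g) * \<phi> (g + h) + ennreal (?f g - ?k g) * \<phi> (- g)"
      by (simp only: density_times_accept)
  qed
  also have "\<dots> = (\<integral>\<^sup>+g. ennreal (?k g) * \<phi> (g + h) \<partial>lborel) + (\<integral>\<^sup>+g. ennreal (?f g - ?k g) * \<phi> (- g) \<partial>lborel)"
    by (subst nn_integral_add) auto
  also have "(\<integral>\<^sup>+g. ennreal (?k g) * \<phi> (g + h) \<partial>lborel) = (\<integral>\<^sup>+g. ennreal (?k (g - h)) * \<phi> g \<partial>lborel)"
    by (subst nn_integral_lborel_translate[where h = h, symmetric]) auto
  also have "(\<integral>\<^sup>+g. ennreal (?f g - ?k g) * \<phi> (- g) \<partial>lborel)
      = (\<integral>\<^sup>+g. ennreal (?f (- g) - ?k (- g)) * \<phi> g \<partial>lborel)"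
    by (subst nn_integral_lborel_uminus[symmetric]) auto
  also have "(\<integral>\<^sup>+g. ennreal (?k (g - h)) * \<phi> g \<partial>lborel) + \<dots>
      = (\<integral>\<^sup>+g. ennreal (?k (g - h)) * \<phi> g + ennreal (?f (- g) - ?k (- g)) * \<phi> g \<partial>lborel)"
    by (subst nn_integral_add) auto
  also have "\<dots> = (\<integral>\<^sup>+g. ennreal (?f g) * \<phi> g \<partial>lborel)"
  proof (intro nn_integral_cong)
    fix g :: 'a
    have "?f (- g) = ?f g" "?f (- g + h) = ?f (g - h)"
      by (simp_all add: std_gaussian_density_def norm_minus_commute[of h])
    then have "?k (g - h) = min (?f g) (?f (g - h))" "?f (- g) - ?k (- g) = ?f g - min (?f g) (?f (g - h))"
      by (simp_all add: min.commute)
    then show "ennreal (?k (g - h)) * \<phi> g + ennreal (?f (- g) - ?k (- g)) * \<phi> g = ennreal (?f g) * \<phi> g"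
      using std_gaussian_density_nonneg[of g] std_gaussian_density_nonneg[of "g - h"]
      by (simp flip: distrib_right ennreal_plus)
  qed
  also have "\<dots> = (\<integral>\<^sup>+g. \<phi> g \<partial>std_gaussian)"
    unfolding std_gaussian_eq by (subst nn_integral_density) auto
  finally show ?thesis .
qed

text \<open>\<open>g \<bullet> h\<close> is normal with deviation \<open>|h|\<close>, so its density
  is at most \<open>1 / (sqrt (2\<pi>) |h|)\<close>; the slab has width
  \<open>|h|\<^sup>2\<close>.\<close>

lemma emeasure_std_gaussian_slab:
  fixes h :: "'a::euclidean_space"
  shows "emeasure std_gaussian {g. - ((norm h)\<^sup>2 / 2) < g \<bullet> h \<and> g \<bullet> h \<le> (norm h)\<^sup>2 / 2}
    \<le> ennreal (norm h / sqrt (2 * pi))"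
proof (cases "h = 0")
  case False
  let ?c = "(norm h)\<^sup>2 / 2"
  have "emeasure std_gaussian {g. - ?c < g \<bullet> h \<and> g \<bullet> h \<le> ?c}
      = emeasure (distr std_gaussian lborel (\<lambda>g. g \<bullet> h)) {- ?c<..?c}"
    by (subst emeasure_distr) (auto simp: vimage_def)
  also have "\<dots> = (\<integral>\<^sup>+x. ennreal (normal_density 0 (norm h) x) * indicator {- ?c<..?c} x \<partial>lborel)"
    using distributed_std_gaussian_inner[OF False] by (simp add: distributed_def emeasure_density)
  also have "\<dots> \<le> (\<integral>\<^sup>+x. ennreal (1 / (sqrt (2 * pi) * norm h)) * indicator {- ?c<..?c} x \<partial>lborel)"
  proof (intro nn_integral_mono mult_right_mono ennreal_leI)
    fix x :: real
    have "1 / (sqrt (2 * pi) * norm h) * exp (- (x - 0)\<^sup>2 / (2 * (norm h)\<^sup>2)) \<le> 1 / (sqrt (2 * pi) * norm h) * 1"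
      by (intro mult_left_mono) auto
    then show "normal_density 0 (norm h) x \<le> 1 / (sqrt (2 * pi) * norm h)"
      by (simp add: normal_density_def real_sqrt_mult)
  qed simp
  also have "\<dots> = ennreal (1 / (sqrt (2 * pi) * norm h)) * ennreal ((norm h)\<^sup>2)"
    by (subst nn_integral_cmult_indicator) auto
  also have "\<dots> = ennreal (norm h / sqrt (2 * pi))"
    using False by (subst ennreal_mult[symmetric]) (auto simp: power2_eq_square)
  finally show ?thesis .
qed simp

text \<open>Rejection has positive probability exactly on the half-space \<open>?A\<close> where
  \<open>f (g + h) < f g\<close>. There the rejected mass is the integral of
  \<open>f g - f (g + h)\<close>, which is the Gaussian mass of \<open>?A\<close> minus that of its
  translate \<open>?A'\<close>, that is, the mass of the slab between them.\<close>

lemma nn_integral_rejection_le: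
  fixes h :: "'a::euclidean_space"
  shows "(\<integral>\<^sup>+g. ennreal (1 - accept h g) \<partial>std_gaussian) \<le> ennreal (min 1 (norm h / sqrt (2 * pi)))"
proof -
  interpret G: prob_space "std_gaussian :: 'a measure" by (rule prob_space_std_gaussian)
  let ?f = "std_gaussian_density :: 'a \<Rightarrow> real"
  let ?c = "(norm h)\<^sup>2 / 2"
  let ?A = "{g. - ?c < g \<bullet> h}" and ?A' = "{g. ?c < g \<bullet> h}" and ?S = "{g. - ?c < g \<bullet> h \<and> g \<bullet> h \<le> ?c}"
  \<comment> \<open>The mass of \<open>?A'\<close> is added on the left so that no subtraction in
    \<open>ennreal\<close> occurs; being finite, it cancels at the end.\<close>
  have "(\<integral>\<^sup>+g. ennreal (1 - accept h g) \<partial>std_gaussian) + emeasure std_gaussian ?A'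
      = (\<integral>\<^sup>+g. ennreal (?f g) * ennreal (1 - accept h g) \<partial>lborel) + (\<integral>\<^sup>+g. ennreal (?f g) * indicator ?A' g \<partial>lborel)"
    unfolding std_gaussian_eq by (subst nn_integral_density, simp, simp, subst emeasure_density) auto
  also have "(\<integral>\<^sup>+g. ennreal (?f g) * indicator ?A' g \<partial>lborel)
      = (\<integral>\<^sup>+g. ennreal (?f (g + h)) * indicator ?A g \<partial>lborel)"
    by (subst nn_integral_lborel_translate[where h = h, symmetric])
      (auto intro!: nn_integral_cong simp: indicator_def inner_simps power2_norm_eq_inner)
  also have "(\<integral>\<^sup>+g. ennreal (?f g) * ennreal (1 - accept h g) \<partial>lborel) + \<dots>
      = (\<integral>\<^sup>+g. ennreal (?f g) * ennreal (1 - accept h g) + ennreal (?f (g + h)) * indicator ?A g \<partial>lborel)"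
    by (subst nn_integral_add) auto
  also have "\<dots> = (\<integral>\<^sup>+g. ennreal (?f g) * indicator ?A g \<partial>lborel)"
  proof (intro nn_integral_cong)
    fix g :: 'a
    have k: "?f g * (1 - accept h g) = ?f g - min (?f g) (?f (g + h))"
      by (simp only: right_diff_distrib density_times_accept mult_1_right)
    show "ennreal (?f g) * ennreal (1 - accept h g) + ennreal (?f (g + h)) * indicator ?A g
        = ennreal (?f g) * indicator ?A g"
    proof (cases "g \<in> ?A")
      case True
      then have "accept h g = exp (- (g \<bullet> h + ?c))" by (simp add: accept_def)
      then have "?f (g + h) = ?f g * accept h g"
        by (simp add: std_gaussian_density_translate)
      then show ?thesis
        using True accept[of h g] std_gaussian_density_nonneg[of g]
        by (simp flip: ennreal_mult ennreal_plus) (simp add: algebra_simps)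
    next
      case False
      then have "accept h g = 1" by (simp add: accept_def min_def)
      with False show ?thesis by simp
    qed
  qed
  also have "\<dots> = emeasure std_gaussian ?A"
    unfolding std_gaussian_eq by (subst emeasure_density) auto
  also have "?A = ?S \<union> ?A'"
  proof -
    have "0 \<le> ?c" by simp
    then have "- ?c < t \<longleftrightarrow> - ?c < t \<and> t \<le> ?c \<or> ?c < t" for t
      by linarith
    then show ?thesis by blast
  qed
  also have "emeasure std_gaussian (?S \<union> ?A') = emeasure std_gaussian ?S + emeasure std_gaussian ?A'"
    by (intro plus_emeasure[symmetric]) auto
  finally have "(\<integral>\<^sup>+g. ennreal (1 - accept h g) \<partial>std_gaussian) = emeasure std_gaussian ?S"
    using G.emeasure_finite[of ?A'] by (simp add: add.commute[of _ "emeasure std_gaussian ?A'"])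
  moreover have "emeasure std_gaussian ?S \<le> 1"
    by (rule G.emeasure_le_1)
  ultimately show ?thesis
    using emeasure_std_gaussian_slab[of h] by (auto simp: min_def)
qed

lemma distr_translate_or_reflect:
  fixes h :: "'a::euclidean_space"
  shows "distr (std_gaussian \<Otimes>\<^sub>M uniform01) borel (translate_or_reflect h) = std_gaussian"
proof (rule measure_eqI)
  interpret u: prob_space uniform01 by (rule prob_space_uniform01)
  have [measurable]: "translate_or_reflect h \<in> std_gaussian \<Otimes>\<^sub>M uniform01 \<rightarrow>\<^sub>M borel"
    unfolding translate_or_reflect_def by measurable
  fix A assume "A \<in> sets (distr (std_gaussian \<Otimes>\<^sub>M uniform01) borel (translate_or_reflect h))"
  then have [measurable]: "A \<in> sets borel" by simp
  have "emeasure (distr (std_gaussian \<Otimes>\<^sub>M uniform01) borel (translate_or_reflect h)) A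
      = (\<integral>\<^sup>+g. indicator A g \<partial>distr (std_gaussian \<Otimes>\<^sub>M uniform01) borel (translate_or_reflect h))"
    by simp
  also have "\<dots> = (\<integral>\<^sup>+g. (\<integral>\<^sup>+u. indicator A (translate_or_reflect h (g, u)) \<partial>uniform01) \<partial>std_gaussian)"
    by (subst nn_integral_distr, simp, simp, subst u.nn_integral_fst[symmetric]) auto
  also have "\<dots> = emeasure std_gaussian A"
    by (subst nn_integral_translate_or_reflect) auto
  finally show "emeasure (distr (std_gaussian \<Otimes>\<^sub>M uniform01) borel (translate_or_reflect h)) A
      = emeasure std_gaussian A" .
qed simp

section \<open>Couplings\<close>

lemma borel_measurable_fst_snd [measurable]:
  "fst \<in> (borel :: ('a::topological_space \<times> 'b::topological_space) measure) \<rightarrow>\<^sub>M borel"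
  "snd \<in> (borel :: ('a::topological_space \<times> 'b::topological_space) measure) \<rightarrow>\<^sub>M borel"
  by (auto intro!: borel_measurable_continuous_onI continuous_intros)

lemma prob_algebra_borel_iff:
  "\<nu> \<in> space (prob_algebra borel) \<longleftrightarrow> prob_space \<nu> \<and> sets \<nu> = sets borel"
  by (auto simp: space_prob_algebra)

context
  fixes \<nu> \<mu> :: "'s::euclidean_space measure" and \<rho> :: "('s \<times> 's) measure"
  assumes \<nu>: "\<nu> \<in> space (prob_algebra borel)" and \<mu>: "\<mu> \<in> space (prob_algebra borel)"
    and \<rho>: "\<rho> \<in> couplings \<nu> \<mu>"
begin

lemma sets_coupling: "sets \<rho> = sets borel"
  using \<nu> \<mu> \<rho> unfolding couplings_def prob_algebra_borel_iff
  by (simp add: borel_prod[symmetric] cong: sets_pair_measure_cong)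

lemma space_coupling: "space \<rho> = UNIV"
  using sets_eq_imp_space_eq[OF sets_coupling] by simp

lemma measurable_coupling: "measurable \<rho> M = borel \<rightarrow>\<^sub>M M"
  by (rule measurable_cong_sets[OF sets_coupling refl])

lemma distr_coupling: "distr \<rho> borel fst = \<nu>" "distr \<rho> borel snd = \<mu>"
  using \<nu> \<mu> \<rho> unfolding couplings_def prob_algebra_borel_iff
  by (auto cong: distr_cong)

lemma prob_space_coupling: "prob_space \<rho>"
proof (rule prob_space_distrD)
  show "fst \<in> \<rho> \<rightarrow>\<^sub>M borel" by (simp add: measurable_coupling)
  show "prob_space (distr \<rho> borel fst)"
    using \<nu> by (simp add: distr_coupling prob_algebra_borel_iff)
qed

lemma nn_integral_coupling:
  assumes "f \<in> borel_measurable borel"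
  shows "(\<integral>\<^sup>+p. f (fst p) \<partial>\<rho>) = (\<integral>\<^sup>+x. f x \<partial>\<nu>)" "(\<integral>\<^sup>+p. f (snd p) \<partial>\<rho>) = (\<integral>\<^sup>+x. f x \<partial>\<mu>)"
  by (subst distr_coupling(1)[symmetric] distr_coupling(2)[symmetric],
      subst nn_integral_distr; simp add: assms measurable_coupling borel_measurable_fst_snd)+

end

lemma couplingsI:
  fixes \<rho> :: "('s::euclidean_space \<times> 's) measure"
  assumes "\<nu> \<in> space (prob_algebra borel)" "\<mu> \<in> space (prob_algebra borel)"
    and "sets \<rho> = sets borel" "distr \<rho> borel fst = \<nu>" "distr \<rho> borel snd = \<mu>"
  shows "\<rho> \<in> couplings \<nu> \<mu>"
proof -
  have "sets \<nu> = sets borel" "sets \<mu> = sets borel"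
    using assms by (auto simp: prob_algebra_borel_iff)
  moreover from this have "sets (\<nu> \<Otimes>\<^sub>M \<mu>) = sets borel"
    by (simp add: borel_prod[symmetric] cong: sets_pair_measure_cong)
  moreover have "distr \<rho> \<nu> fst = distr \<rho> borel fst" "distr \<rho> \<mu> snd = distr \<rho> borel snd"
    using calculation by (auto intro: distr_cong)
  ultimately show ?thesis
    using assms by (simp add: couplings_def)
qed

lemma pair_measure_couplings:
  fixes \<nu> \<mu> :: "'s::euclidean_space measure"
  assumes \<nu>: "\<nu> \<in> space (prob_algebra borel)" and \<mu>: "\<mu> \<in> space (prob_algebra borel)"
  shows "\<nu> \<Otimes>\<^sub>M \<mu> \<in> couplings \<nu> \<mu>"
proof -
  interpret N: prob_space \<nu> using \<nu> by (simp add: prob_algebra_borel_iff)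
  interpret M: prob_space \<mu> using \<mu> by (simp add: prob_algebra_borel_iff)
  interpret NM: pair_prob_space \<nu> \<mu> ..
  have "distr (\<nu> \<Otimes>\<^sub>M \<mu>) \<mu> snd = distr (\<mu> \<Otimes>\<^sub>M \<nu>) \<mu> fst"
    by (subst NM.distr_pair_swap) (simp add: distr_distr comp_def split_beta)
  then show ?thesis
    by (simp add: couplings_def M.distr_pair_fst N.distr_pair_fst)
qed

text \<open>If the randomly chosen pair of maps \<open>\<Phi>\<close>, \<open>\<Psi>\<close> realises one step of the
  kernel from either component, applying it to a coupling of two laws yields a coupling of the
  laws one step later.\<close>

lemma coupling_step:
  fixes \<nu> \<mu> :: "'s::euclidean_space measure" and \<Phi> \<Psi> :: "'s \<times> 's \<Rightarrow> 'w \<Rightarrow> 's"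
  assumes \<nu>: "\<nu> \<in> space (prob_algebra borel)" and \<mu>: "\<mu> \<in> space (prob_algebra borel)"
    and \<rho>: "\<rho> \<in> couplings \<nu> \<mu>" and "prob_space \<Omega>"
    and K: "K \<in> borel \<rightarrow>\<^sub>M prob_algebra borel"
    and [measurable]: "(\<lambda>(p, \<omega>). \<Phi> p \<omega>) \<in> borel \<Otimes>\<^sub>M \<Omega> \<rightarrow>\<^sub>M borel"
      "(\<lambda>(p, \<omega>). \<Psi> p \<omega>) \<in> borel \<Otimes>\<^sub>M \<Omega> \<rightarrow>\<^sub>M borel"
    and \<Phi>: "\<And>p. distr \<Omega> borel (\<Phi> p) = K (fst p)"
    and \<Psi>: "\<And>p. distr \<Omega> borel (\<Psi> p) = K (snd p)"
  shows "distr (\<rho> \<Otimes>\<^sub>M \<Omega>) borel (\<lambda>(p, \<omega>). (\<Phi> p \<omega>, \<Psi> p \<omega>)) \<in> couplings (\<nu> \<bind> K) (\<mu> \<bind> K)"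
proof -
  interpret \<Omega>: prob_space \<Omega> by fact
  have [measurable_cong]: "sets \<rho> = sets borel" using \<nu> \<mu> \<rho> by (rule sets_coupling)
  have marginal: "distr (\<rho> \<Otimes>\<^sub>M \<Omega>) borel (\<lambda>(p, \<omega>). X p \<omega>) = \<xi> \<bind> K"
    if X [measurable]: "(\<lambda>(p, \<omega>). X p \<omega>) \<in> borel \<Otimes>\<^sub>M \<Omega> \<rightarrow>\<^sub>M borel"
      and XK: "\<And>p. distr \<Omega> borel (X p) = K (\<pi> p)" and \<xi>: "distr \<rho> borel \<pi> = \<xi>" "\<xi> \<in> space (prob_algebra borel)"
      and [measurable]: "\<pi> \<in> borel \<rightarrow>\<^sub>M borel"
    for X \<pi> and \<xi> :: "'s measure"
  proof (rule measure_eqI)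
    have sets: "sets (\<xi> \<bind> K) = sets borel"
      using sets_bind'[OF \<xi>(2) K] by simp
    then show "sets (distr (\<rho> \<Otimes>\<^sub>M \<Omega>) borel (\<lambda>(p, \<omega>). X p \<omega>)) = sets (\<xi> \<bind> K)"
      by simp
    fix A assume "A \<in> sets (distr (\<rho> \<Otimes>\<^sub>M \<Omega>) borel (\<lambda>(p, \<omega>). X p \<omega>))"
    then have [measurable]: "A \<in> sets borel" by simp
    have "emeasure (distr (\<rho> \<Otimes>\<^sub>M \<Omega>) borel (\<lambda>(p, \<omega>). X p \<omega>)) A
        = (\<integral>\<^sup>+z. indicator A z \<partial>distr (\<rho> \<Otimes>\<^sub>M \<Omega>) borel (\<lambda>(p, \<omega>). X p \<omega>))"
      by simp
    also have "\<dots> = (\<integral>\<^sup>+z. indicator A (X (fst z) (snd z)) \<partial>(\<rho> \<Otimes>\<^sub>M \<Omega>))"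
      by (subst nn_integral_distr) (auto simp: split_beta)
    also have "\<dots> = (\<integral>\<^sup>+p. (\<integral>\<^sup>+\<omega>. indicator A (X p \<omega>) \<partial>\<Omega>) \<partial>\<rho>)"
      by (subst \<Omega>.nn_integral_fst[symmetric]) auto
    also have "\<dots> = (\<integral>\<^sup>+p. emeasure (distr \<Omega> borel (X p)) A \<partial>\<rho>)"
    proof (intro nn_integral_cong)
      fix p
      have [measurable]: "X p \<in> \<Omega> \<rightarrow>\<^sub>M borel"
        using measurable_compose[OF measurable_Pair1' X, of p] by simp
      have "(\<integral>\<^sup>+\<omega>. indicator A (X p \<omega>) \<partial>\<Omega>) = (\<integral>\<^sup>+z. indicator A z \<partial>distr \<Omega> borel (X p))"
        by (subst nn_integral_distr) auto
      then show "(\<integral>\<^sup>+\<omega>. indicator A (X p \<omega>) \<partial>\<Omega>) = emeasure (distr \<Omega> borel (X p)) A"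
        by simp
    qed
    also have "\<dots> = (\<integral>\<^sup>+x. emeasure (K x) A \<partial>distr \<rho> borel \<pi>)"
      using measurable_prob_algebraD[OF K]
      by (subst nn_integral_distr) (auto simp: XK intro!: measurable_emeasure_subprob_algebra[THEN measurable_compose_rev])
    also have "\<dots> = emeasure (\<xi> \<bind> K) A"
      using \<xi> K by (subst emeasure_bind_prob_algebra) auto
    finally show "emeasure (distr (\<rho> \<Otimes>\<^sub>M \<Omega>) borel (\<lambda>(p, \<omega>). X p \<omega>)) A = emeasure (\<xi> \<bind> K) A" .
  qed
  have "\<nu> \<bind> K \<in> space (prob_algebra borel)" "\<mu> \<bind> K \<in> space (prob_algebra borel)"
    using \<nu> \<mu> K prob_space_bind'[OF _ K] sets_bind'[OF _ K]
    by (auto simp: prob_algebra_borel_iff)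
  moreover have "distr (\<rho> \<Otimes>\<^sub>M \<Omega>) borel (\<lambda>(p, \<omega>). \<Phi> p \<omega>) = \<nu> \<bind> K"
    using \<Phi> distr_coupling[OF \<nu> \<mu> \<rho>] \<nu> by (intro marginal) auto
  moreover have "distr (\<rho> \<Otimes>\<^sub>M \<Omega>) borel (\<lambda>(p, \<omega>). \<Psi> p \<omega>) = \<mu> \<bind> K"
    using \<Psi> distr_coupling[OF \<nu> \<mu> \<rho>] \<mu> by (intro marginal) auto
  ultimately show ?thesis
    by (intro couplingsI) (auto simp: distr_distr comp_def split_beta')
qed

text \<open>No coupling is assumed to attain the infimum. For each \<open>e\<close> a coupling with
  disagreement below \<open>e\<close> makes the two masses of any Borel set differ by at most
  \<open>e\<close>.\<close>

lemma tv_dist_zero_imp_eq: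
  fixes \<nu> \<mu> :: "'s::euclidean_space measure"
  assumes \<nu>: "\<nu> \<in> space (prob_algebra borel)" and \<mu>: "\<mu> \<in> space (prob_algebra borel)"
    and 0: "tv_dist \<nu> \<mu> = 0"
  shows "\<nu> = \<mu>"
proof (rule measure_eqI)
  have sets: "sets \<nu> = sets borel" "sets \<mu> = sets borel"
    using \<nu> \<mu> by (auto simp: prob_algebra_borel_iff)
  then show "sets \<nu> = sets \<mu>" by simp
  fix A assume "A \<in> sets \<nu>"
  then have [measurable]: "A \<in> sets borel" using sets by simp
  have le: "emeasure \<nu> A \<le> emeasure \<mu> A + e \<and> emeasure \<mu> A \<le> emeasure \<nu> A + e" if "0 < e" for e
  proof -
    obtain \<rho> where \<rho>: "\<rho> \<in> couplings \<nu> \<mu>" and e: "2 * emeasure \<rho> {p \<in> space \<rho>. fst p \<noteq> snd p} < e"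
    proof -
      have "(INF \<rho>\<in>couplings \<nu> \<mu>. 2 * emeasure \<rho> {p \<in> space \<rho>. fst p \<noteq> snd p}) < e"
        using 0 \<open>0 < e\<close> by (simp add: tv_dist_def)
      then show thesis
        unfolding INF_less_iff using that by blast
    qed
    note c = sets_coupling[OF \<nu> \<mu> \<rho>] space_coupling[OF \<nu> \<mu> \<rho>]
    let ?N = "{p. fst p \<noteq> snd p} :: ('s \<times> 's) set"
    have [measurable]: "?N \<in> sets \<rho>"
      unfolding c by measurable
    have [measurable]: "fst -` A \<in> sets \<rho>" "snd -` A \<in> sets \<rho>"
      unfolding c by (auto intro!: measurable_sets_borel[of _ borel])
    have A: "emeasure \<nu> A = emeasure \<rho> (fst -` A)" "emeasure \<mu> A = emeasure \<rho> (snd -` A)"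
      by (auto simp: distr_coupling[OF \<nu> \<mu> \<rho>, symmetric] emeasure_distr measurable_coupling[OF \<nu> \<mu> \<rho>] c)
    have "emeasure \<rho> ?N \<le> 2 * emeasure \<rho> ?N"
      by (simp add: mult_2)
    with e have N: "emeasure \<rho> ?N \<le> e"
      by (simp add: c)
    have "emeasure \<rho> (fst -` A) \<le> emeasure \<rho> (snd -` A \<union> ?N)" "emeasure \<rho> (snd -` A) \<le> emeasure \<rho> (fst -` A \<union> ?N)"
      by (intro emeasure_mono; auto)+
    moreover have "emeasure \<rho> (snd -` A \<union> ?N) \<le> emeasure \<rho> (snd -` A) + emeasure \<rho> ?N"
      "emeasure \<rho> (fst -` A \<union> ?N) \<le> emeasure \<rho> (fst -` A) + emeasure \<rho> ?N"
      by (intro emeasure_subadditive; measurable)+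
    ultimately show ?thesis
      unfolding A using N by (meson add_left_mono order_trans)
  qed
  show "emeasure \<nu> A = emeasure \<mu> A"
  proof (rule antisym)
    show "emeasure \<nu> A \<le> emeasure \<mu> A" "emeasure \<mu> A \<le> emeasure \<nu> A"
      by (rule ennreal_le_epsilon, use le in simp)+
  qed
qed

section \<open>Contracting random maps\<close>

locale random_map = prob_space \<Gamma> for \<Gamma> :: "'w measure" +
  fixes F :: "'s::euclidean_space \<Rightarrow> 'w \<Rightarrow> 's"
  assumes F_measurable [measurable]: "(\<lambda>(z, \<omega>). F z \<omega>) \<in> borel \<Otimes>\<^sub>M \<Gamma> \<rightarrow>\<^sub>M borel"
begin

definition kernel :: "'s \<Rightarrow> 's measure" where "kernel z = distr \<Gamma> borel (F z)"

lemma measurable_F [measurable]: "F z \<in> \<Gamma> \<rightarrow>\<^sub>M borel"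
  using measurable_compose[OF measurable_Pair1' F_measurable, of z] by simp

lemma measurable_kernel [measurable]: "kernel \<in> borel \<rightarrow>\<^sub>M prob_algebra borel"
proof -
  have "(\<lambda>_. \<Gamma>) \<in> borel \<rightarrow>\<^sub>M prob_algebra \<Gamma>"
    by (intro measurable_const) (simp add: space_prob_algebra prob_space_axioms)
  then show ?thesis
    unfolding kernel_def[abs_def] by measurable
qed

lemma bind_kernel_prob:
  "\<nu> \<in> space (prob_algebra borel) \<Longrightarrow> \<nu> \<bind> kernel \<in> space (prob_algebra borel)"
  using prob_space_bind'[OF _ measurable_kernel] sets_bind'[OF _ measurable_kernel]
  by (simp add: prob_algebra_borel_iff)

lemma law_after_0: "law_after kernel \<nu> 0 = \<nu>"
  and law_after_Suc: "law_after kernel \<nu> (Suc n) = law_after kernel \<nu> n \<bind> kernel"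
  by (simp_all add: law_after_def)

lemma law_after_prob:
  "\<nu> \<in> space (prob_algebra borel) \<Longrightarrow> law_after kernel \<nu> n \<in> space (prob_algebra borel)"
  by (induction n) (auto simp: law_after_0 law_after_Suc intro: bind_kernel_prob)

lemma law_after_invariant: "invariant_prob kernel \<pi> \<Longrightarrow> law_after kernel \<pi> n = \<pi>"
  by (induction n) (auto simp: law_after_0 law_after_Suc invariant_prob_def)

end

text \<open>\<open>N\<close> enters only through its comparison with the norm, which lets a twisted
  gauge such as \<open>lyap\<close> be used. The contraction holds for every noise value, hence
  survives any monotone function. The cap at 1 in \<open>regularization\<close> makes it meaningful
  for couplings without moments.\<close>

locale contracting_random_map = random_map \<Gamma> F
  for \<Gamma> :: "'w measure" and F :: "'s::euclidean_space \<Rightarrow> 'w \<Rightarrow> 's" +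
  fixes N :: "'s \<Rightarrow> real" and r c C q :: real
  assumes N_measurable [measurable]: "N \<in> borel_measurable borel"
    and N_nonneg: "0 \<le> N z"
    and norm_le_N: "norm z \<le> c * N z" and N_le_norm: "N z \<le> C * norm z"
    and r: "0 < r" "r < 1" and c: "0 \<le> c" and C: "0 \<le> C" and q: "0 \<le> q"
    and contraction: "N (F z \<omega> - F z' \<omega>) \<le> r * N (z - z')"
    and first_moment: "(\<integral>\<^sup>+\<omega>. ennreal (norm (F 0 \<omega>)) \<partial>\<Gamma>) < \<infinity>"
    and regularization: "\<lbrakk>\<nu> \<in> space (prob_algebra borel); \<mu> \<in> space (prob_algebra borel); \<rho> \<in> couplings \<nu> \<mu>\<rbrakk>
      \<Longrightarrow> tv_dist (\<nu> \<bind> kernel) (\<mu> \<bind> kernel) \<le> (\<integral>\<^sup>+p. 2 * ennreal (min 1 (q * N (fst p - snd p))) \<partial>\<rho>)"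
begin

text \<open>One coupling serves all monotone \<open>\<phi>\<close> at once. The generality in
  \<open>\<phi>\<close> is also what makes the induction work, since each step replaces
  \<open>\<phi>\<close> by \<open>\<lambda>x. \<phi> (r * x)\<close>.\<close>

lemma synchronous_coupling:
  assumes \<nu>: "\<nu> \<in> space (prob_algebra borel)" and \<mu>: "\<mu> \<in> space (prob_algebra borel)"
    and \<rho>: "\<rho> \<in> couplings \<nu> \<mu>"
  shows "\<exists>\<rho>'\<in>couplings (law_after kernel \<nu> n) (law_after kernel \<mu> n).
    \<forall>\<phi>::real \<Rightarrow> ennreal. mono \<phi> \<longrightarrow> \<phi> \<in> borel_measurable borel \<longrightarrow>
      (\<integral>\<^sup>+p. \<phi> (N (fst p - snd p)) \<partial>\<rho>') \<le> (\<integral>\<^sup>+p. \<phi> (r ^ n * N (fst p - snd p)) \<partial>\<rho>)"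
proof (induction n)
  case 0
  show ?case using \<rho> by (auto simp: law_after_0 intro!: bexI[of _ \<rho>])
next
  case (Suc n)
  let ?\<nu> = "law_after kernel \<nu> n" and ?\<mu> = "law_after kernel \<mu> n"
  obtain \<rho>' where \<rho>': "\<rho>' \<in> couplings ?\<nu> ?\<mu>"
    and IH: "\<And>\<phi>::real \<Rightarrow> ennreal. mono \<phi> \<Longrightarrow> \<phi> \<in> borel_measurable borel \<Longrightarrow>
      (\<integral>\<^sup>+p. \<phi> (N (fst p - snd p)) \<partial>\<rho>') \<le> (\<integral>\<^sup>+p. \<phi> (r ^ n * N (fst p - snd p)) \<partial>\<rho>)"
    using Suc by blast
  let ?\<rho> = "distr (\<rho>' \<Otimes>\<^sub>M \<Gamma>) borel (\<lambda>(p, \<omega>). (F (fst p) \<omega>, F (snd p) \<omega>))"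
  have \<nu>': "?\<nu> \<in> space (prob_algebra borel)" and \<mu>': "?\<mu> \<in> space (prob_algebra borel)"
    using \<nu> \<mu> by (auto intro: law_after_prob)
  have [measurable_cong]: "sets \<rho>' = sets borel" using \<nu>' \<mu>' \<rho>' by (rule sets_coupling)
  have m1 [measurable]: "(\<lambda>(p, \<omega>). F (fst p) \<omega>) \<in> borel \<Otimes>\<^sub>M \<Gamma> \<rightarrow>\<^sub>M borel"
    and m2 [measurable]: "(\<lambda>(p, \<omega>). F (snd p) \<omega>) \<in> borel \<Otimes>\<^sub>M \<Gamma> \<rightarrow>\<^sub>M borel"
    by measurable
  have "?\<rho> \<in> couplings (?\<nu> \<bind> kernel) (?\<mu> \<bind> kernel)"
    using \<nu>' \<mu>' \<rho>' prob_space_axioms measurable_kernel m1 m2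
    by (rule coupling_step) (simp_all add: kernel_def)
  moreover have "(\<integral>\<^sup>+p. \<phi> (N (fst p - snd p)) \<partial>?\<rho>) \<le> (\<integral>\<^sup>+p. \<phi> (r ^ Suc n * N (fst p - snd p)) \<partial>\<rho>)"
    if \<phi>: "mono \<phi>" and [measurable]: "\<phi> \<in> borel_measurable borel" for \<phi> :: "real \<Rightarrow> ennreal"
  proof -
    have "(\<integral>\<^sup>+p. \<phi> (N (fst p - snd p)) \<partial>?\<rho>)
        = (\<integral>\<^sup>+x. \<phi> (N (F (fst (fst x)) (snd x) - F (snd (fst x)) (snd x))) \<partial>(\<rho>' \<Otimes>\<^sub>M \<Gamma>))"
      by (subst nn_integral_distr) (auto simp: split_beta')
    also have "\<dots> \<le> (\<integral>\<^sup>+x. \<phi> (r * N (fst (fst x) - snd (fst x))) \<partial>(\<rho>' \<Otimes>\<^sub>M \<Gamma>))"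
      by (intro nn_integral_mono monoD[OF \<phi>] contraction)
    also have "\<dots> = (\<integral>\<^sup>+p. (\<integral>\<^sup>+\<omega>. \<phi> (r * N (fst p - snd p)) \<partial>\<Gamma>) \<partial>\<rho>')"
      by (subst nn_integral_fst[symmetric]) auto
    also have "\<dots> = (\<integral>\<^sup>+p. \<phi> (r * N (fst p - snd p)) \<partial>\<rho>')"
      by (simp add: emeasure_space_1)
    also have "\<dots> \<le> (\<integral>\<^sup>+p. \<phi> (r * (r ^ n * N (fst p - snd p))) \<partial>\<rho>)"
    proof (rule IH[of "\<lambda>x. \<phi> (r * x)"])
      show "mono (\<lambda>x. \<phi> (r * x))"
        using r by (intro monoI monoD[OF \<phi>] mult_left_mono) auto
    qed measurable
    finally show ?thesis by (simp add: mult.assoc)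
  qed
  ultimately show ?case
    unfolding law_after_Suc by blast
qed

text \<open>Of the \<open>Suc n\<close> steps the first \<open>n\<close> contract and the last one
  regularizes; hence the exponent \<open>n - 1\<close> in the theorem.\<close>

lemma tv_dist_law_after_le:
  assumes \<nu>: "\<nu> \<in> space (prob_algebra borel)" and \<mu>: "\<mu> \<in> space (prob_algebra borel)"
    and \<rho>: "\<rho> \<in> couplings \<nu> \<mu>"
  shows "tv_dist (law_after kernel \<nu> (Suc n)) (law_after kernel \<mu> (Suc n))
    \<le> (\<integral>\<^sup>+p. 2 * ennreal (min 1 (q * (r ^ n * N (fst p - snd p)))) \<partial>\<rho>)"
proof -
  let ?\<phi> = "\<lambda>x. 2 * ennreal (min 1 (q * x))"
  obtain \<rho>' where \<rho>': "\<rho>' \<in> couplings (law_after kernel \<nu> n) (law_after kernel \<mu> n)"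
    and *: "\<And>\<phi>::real \<Rightarrow> ennreal. mono \<phi> \<Longrightarrow> \<phi> \<in> borel_measurable borel \<Longrightarrow>
      (\<integral>\<^sup>+p. \<phi> (N (fst p - snd p)) \<partial>\<rho>') \<le> (\<integral>\<^sup>+p. \<phi> (r ^ n * N (fst p - snd p)) \<partial>\<rho>)"
    using synchronous_coupling[OF assms] by blast
  have "tv_dist (law_after kernel \<nu> (Suc n)) (law_after kernel \<mu> (Suc n))
      \<le> (\<integral>\<^sup>+p. ?\<phi> (N (fst p - snd p)) \<partial>\<rho>')"
    unfolding law_after_Suc using \<nu> \<mu> \<rho>' by (intro regularization law_after_prob)
  also have "\<dots> \<le> (\<integral>\<^sup>+p. ?\<phi> (r ^ n * N (fst p - snd p)) \<partial>\<rho>)"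
  proof (rule *[of ?\<phi>])
    show "mono ?\<phi>"
    proof (rule monoI)
      fix x y :: real assume "x \<le> y"
      then have "q * x \<le> q * y" using q by (rule mult_left_mono)
      then show "?\<phi> x \<le> ?\<phi> y"
        by (intro mult_left_mono[of "ennreal _"] ennreal_leI min.mono) auto
    qed
  qed measurable
  finally show ?thesis .
qed

lemma tv_dist_law_after_le_norm:
  assumes \<nu>: "\<nu> \<in> space (prob_algebra borel)" and \<mu>: "\<mu> \<in> space (prob_algebra borel)"
    and \<rho>: "\<rho> \<in> couplings \<nu> \<mu>"
  shows "tv_dist (law_after kernel \<nu> (Suc n)) (law_after kernel \<mu> (Suc n))
    \<le> ennreal (2 * q * C * r ^ n) * (\<integral>\<^sup>+p. ennreal (norm (fst p - snd p)) \<partial>\<rho>)"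
proof -
  have [measurable_cong]: "sets \<rho> = sets borel" using assms by (rule sets_coupling)
  note tv_dist_law_after_le[OF assms, of n]
  also have "(\<integral>\<^sup>+p. 2 * ennreal (min 1 (q * (r ^ n * N (fst p - snd p)))) \<partial>\<rho>)
      \<le> (\<integral>\<^sup>+p. ennreal (2 * q * C * r ^ n) * ennreal (norm (fst p - snd p)) \<partial>\<rho>)"
  proof (intro nn_integral_mono)
    fix p :: "'s \<times> 's"
    have "min 1 (q * (r ^ n * N (fst p - snd p))) \<le> q * (r ^ n * (C * norm (fst p - snd p)))"
      using q r by (intro min.coboundedI2 mult_left_mono N_le_norm) auto
    then have "2 * ennreal (min 1 (q * (r ^ n * N (fst p - snd p))))
        \<le> 2 * ennreal (q * (r ^ n * (C * norm (fst p - snd p))))"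
      by (intro mult_left_mono ennreal_leI) auto
    also have "\<dots> = ennreal (2 * (q * (r ^ n * (C * norm (fst p - snd p)))))"
      by (subst ennreal_mult'') (use q r C in auto)
    also have "\<dots> = ennreal (2 * q * C * r ^ n * norm (fst p - snd p))"
      by (simp add: mult_ac)
    also have "\<dots> = ennreal (2 * q * C * r ^ n) * ennreal (norm (fst p - snd p))"
      by (rule ennreal_mult'') simp
    finally show "2 * ennreal (min 1 (q * (r ^ n * N (fst p - snd p)))) \<le> \<dots>" .
  qed
  also have "\<dots> = ennreal (2 * q * C * r ^ n) * (\<integral>\<^sup>+p. ennreal (norm (fst p - snd p)) \<partial>\<rho>)"
    by (intro nn_integral_cmult) measurable
  finally show ?thesis .
qed

text \<open>An invariant law might have infinite first moment, so its Wasserstein distance to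
  another one gives nothing. With the product coupling the truncated bound is dominated by 2 and
  tends to 0 pointwise, while invariance keeps the left side constant.\<close>

lemma invariant_prob_unique:
  assumes "invariant_prob kernel \<pi>" "invariant_prob kernel \<pi>'"
  shows "\<pi> = \<pi>'"
proof (rule tv_dist_zero_imp_eq)
  show \<pi>: "\<pi> \<in> space (prob_algebra borel)" and \<pi>': "\<pi>' \<in> space (prob_algebra borel)"
    using assms by (auto simp: invariant_prob_def prob_algebra_borel_iff)
  let ?\<rho> = "\<pi> \<Otimes>\<^sub>M \<pi>'"
  note \<rho> = pair_measure_couplings[OF \<pi> \<pi>']
  interpret \<rho>: prob_space ?\<rho> using \<pi> \<pi>' \<rho> by (rule prob_space_coupling)
  have [measurable_cong]: "sets ?\<rho> = sets borel" using \<pi> \<pi>' \<rho> by (rule sets_coupling)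
  have "(\<lambda>n. \<integral>\<^sup>+p. 2 * ennreal (min 1 (q * (r ^ n * N (fst p - snd p)))) \<partial>?\<rho>) \<longlonglongrightarrow> (\<integral>\<^sup>+p. 0 \<partial>?\<rho>)"
  proof (rule nn_integral_dominated_convergence[where w = "\<lambda>_. 2"])
    show "AE p in ?\<rho>. 2 * ennreal (min 1 (q * (r ^ n * N (fst p - snd p)))) \<le> 2" for n
    proof (intro AE_I2)
      fix p
      have "2 * ennreal (min 1 (q * (r ^ n * N (fst p - snd p)))) \<le> 2 * ennreal 1"
        by (intro mult_left_mono ennreal_leI) auto
      then show "2 * ennreal (min 1 (q * (r ^ n * N (fst p - snd p)))) \<le> 2" by simp
    qed
    show "AE p in ?\<rho>. (\<lambda>n. 2 * ennreal (min 1 (q * (r ^ n * N (fst p - snd p))))) \<longlonglongrightarrow> 0"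
    proof (intro AE_I2)
      fix p
      have "(\<lambda>n. min 1 (q * (r ^ n * N (fst p - snd p)))) \<longlonglongrightarrow> min 1 (q * (0 * N (fst p - snd p)))"
        using r by (intro tendsto_intros LIMSEQ_realpow_zero) auto
      then have "(\<lambda>n. 2 * ennreal (min 1 (q * (r ^ n * N (fst p - snd p))))) \<longlonglongrightarrow> 2 * ennreal 0"
        by (intro ennreal_tendsto_cmult tendsto_ennrealI) auto
      then show "(\<lambda>n. 2 * ennreal (min 1 (q * (r ^ n * N (fst p - snd p))))) \<longlonglongrightarrow> 0" by simp
    qed
    show "(\<integral>\<^sup>+p. 2 \<partial>?\<rho>) < \<infinity>"
      by (simp add: \<rho>.emeasure_space_1)
  qed measurable
  moreover have "tv_dist \<pi> \<pi>' \<le> (\<integral>\<^sup>+p. 2 * ennreal (min 1 (q * (r ^ n * N (fst p - snd p)))) \<partial>?\<rho>)" for n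
    using tv_dist_law_after_le[OF \<pi> \<pi>' \<rho>, of n] assms by (simp add: law_after_invariant)
  ultimately have "tv_dist \<pi> \<pi>' \<le> 0"
    by (intro LIMSEQ_le_const) auto
  then show "tv_dist \<pi> \<pi>' = 0" by simp
qed

end

lemma (in prob_space) nn_integral_snth:
  assumes [measurable]: "f \<in> borel_measurable M"
  shows "(\<integral>\<^sup>+s. f (s !! n) \<partial>stream_space M) = (\<integral>\<^sup>+x. f x \<partial>M)"
proof (induction n)
  interpret S: prob_space "stream_space M" by (rule prob_space_stream_space)
  case 0
  show ?case by (subst nn_integral_stream_space) (auto simp: S.emeasure_space_1)
next
  interpret S: prob_space "stream_space M" by (rule prob_space_stream_space)
  case (Suc n)
  then show ?case by (subst nn_integral_stream_space) (auto simp: emeasure_space_1)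
qed

lemma ln_ennreal_le:
  assumes "t \<le> ennreal y" "0 < y"
  shows "ln_ennreal t \<le> ereal (ln y)"
proof (cases t)
  case (real x)
  with assms have "x \<le> y" by simp
  with real assms show ?thesis
    by (auto simp: ln_ennreal_def)
qed (use assms in \<open>auto simp: top_unique\<close>)

lemma exp_ereal_le:
  assumes "t \<le> ereal (ln y)" "0 < y"
  shows "exp_ereal t \<le> ereal y"
proof (cases t)
  case (real x)
  then have "exp x \<le> y" using assms ln_ge_iff[of y x] by simp
  with real assms show ?thesis by (simp add: exp_ereal_def)
qed (use assms in \<open>auto simp: exp_ereal_def\<close>)

section \<open>Existence of the invariant law and the convergence rate\<close>

context contracting_random_map
begin

text \<open>Composing the random maps in reversed order gives almost surely convergent iterates with
  the same laws as the chain started at \<open>0\<close>; the law of their limit is invariant.\<close>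

primrec backward :: "nat \<Rightarrow> 'w stream \<Rightarrow> 's" where
  "backward 0 s = 0"
| "backward (Suc n) s = F (backward n (stl s)) (shd s)"

text \<open>\<open>lim\<close> is total and unspecified where the iterates diverge. This concerns
  only a null set, and measurability holds everywhere.\<close>

definition backward_limit :: "'w stream \<Rightarrow> 's" where
  "backward_limit s = lim (\<lambda>n. backward n s)"

definition stationary :: "'s measure" where
  "stationary = distr (stream_space \<Gamma>) borel backward_limit"

lemma measurable_backward [measurable]: "backward n \<in> stream_space \<Gamma> \<rightarrow>\<^sub>M borel"
  by (induction n) simp_all

lemma measurable_backward_limit [measurable]: "backward_limit \<in> stream_space \<Gamma> \<rightarrow>\<^sub>M borel"
  unfolding backward_limit_def[abs_def] by measurable

text \<open>Consecutive backward iterates share their \<open>n\<close> outermost maps and differ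
  only in the starting point, \<open>0\<close> against \<open>F 0 (s !! n)\<close>. This is the
  advantage over forward iterates, which do not settle down along a path.\<close>

lemma backward_step_le:
  "N (backward (Suc n) s - backward n s) \<le> r ^ n * N (F 0 (s !! n))"
proof (induction n arbitrary: s)
  case (Suc n)
  have "N (backward (Suc (Suc n)) s - backward (Suc n) s)
      \<le> r * N (backward (Suc n) (stl s) - backward n (stl s))"
    unfolding backward.simps(2)[of "Suc n" s] backward.simps(2)[of n s] by (rule contraction)
  also have "\<dots> \<le> r * (r ^ n * N (F 0 (stl s !! n)))"
    using r Suc by (intro mult_left_mono) auto
  finally show ?case by simp
qed simp

text \<open>A geometric series times the first moment of \<open>F 0\<close>. It yields both the
  almost sure convergence and the first moment of the limit.\<close>

lemma nn_integral_backward_steps: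
  "(\<integral>\<^sup>+s. (\<Sum>n. ennreal (norm (backward (Suc n) s - backward n s))) \<partial>stream_space \<Gamma>) < \<infinity>"
proof -
  let ?M = "\<integral>\<^sup>+\<omega>. ennreal (N (F 0 \<omega>)) \<partial>\<Gamma>"
  have "?M \<le> (\<integral>\<^sup>+\<omega>. ennreal C * ennreal (norm (F 0 \<omega>)) \<partial>\<Gamma>)"
    using C N_le_norm by (intro nn_integral_mono) (auto simp flip: ennreal_mult)
  also have "\<dots> = ennreal C * (\<integral>\<^sup>+\<omega>. ennreal (norm (F 0 \<omega>)) \<partial>\<Gamma>)"
    by (intro nn_integral_cmult) measurable
  also have "\<dots> < \<infinity>"
    using first_moment by (simp add: ennreal_mult_less_top)
  finally have M: "?M < \<infinity>" .
  have "(\<integral>\<^sup>+s. (\<Sum>n. ennreal (norm (backward (Suc n) s - backward n s))) \<partial>stream_space \<Gamma>)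
      = (\<Sum>n. \<integral>\<^sup>+s. ennreal (norm (backward (Suc n) s - backward n s)) \<partial>stream_space \<Gamma>)"
    by (intro nn_integral_suminf) measurable
  also have "\<dots> \<le> (\<Sum>n. ennreal (c * r ^ n) * ?M)"
  proof (intro suminf_le summableI)
    fix n
    have "(\<integral>\<^sup>+s. ennreal (norm (backward (Suc n) s - backward n s)) \<partial>stream_space \<Gamma>)
        \<le> (\<integral>\<^sup>+s. ennreal (c * r ^ n) * ennreal (N (F 0 (s !! n))) \<partial>stream_space \<Gamma>)"
    proof (intro nn_integral_mono)
      fix s
      have "norm (backward (Suc n) s - backward n s) \<le> c * (r ^ n * N (F 0 (s !! n)))"
        using norm_le_N mult_left_mono[OF backward_step_le c] by (rule order_trans)
      then show "ennreal (norm (backward (Suc n) s - backward n s))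
          \<le> ennreal (c * r ^ n) * ennreal (N (F 0 (s !! n)))"
        using c r N_nonneg by (simp add: mult.assoc flip: ennreal_mult)
    qed
    also have "\<dots> = ennreal (c * r ^ n) * (\<integral>\<^sup>+s. ennreal (N (F 0 (s !! n))) \<partial>stream_space \<Gamma>)"
      by (intro nn_integral_cmult) measurable
    also have "(\<integral>\<^sup>+s. ennreal (N (F 0 (s !! n))) \<partial>stream_space \<Gamma>) = ?M"
      by (rule nn_integral_snth) measurable
    finally show "(\<integral>\<^sup>+s. ennreal (norm (backward (Suc n) s - backward n s)) \<partial>stream_space \<Gamma>)
        \<le> ennreal (c * r ^ n) * ?M" .
  qed
  also have "\<dots> = (\<Sum>n. ennreal (c * r ^ n)) * ?M"
    by simp
  also have "(\<Sum>n. ennreal (c * r ^ n)) = ennreal (\<Sum>n. c * r ^ n)"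
    using c r by (intro suminf_ennreal2) (auto intro!: summable_mult summable_geometric)
  also have "ennreal (\<Sum>n. c * r ^ n) * ?M < \<infinity>"
    using M by (simp add: ennreal_mult_less_top)
  finally show ?thesis .
qed

lemma backward_converges:
  assumes "summable (\<lambda>n. norm (backward (Suc n) s - backward n s))"
  shows "(\<lambda>n. backward n s) \<longlonglongrightarrow> backward_limit s"
    and "ennreal (norm (backward_limit s)) \<le> (\<Sum>n. ennreal (norm (backward (Suc n) s - backward n s)))"
proof -
  let ?d = "\<lambda>n. backward (Suc n) s - backward n s"
  have "(\<Sum>i<n. ?d i) = backward n s" for n
    by (subst sum_lessThan_telescope) simp
  then have *: "(\<lambda>n. backward n s) \<longlonglongrightarrow> suminf ?d"
    using summable_LIMSEQ[OF summable_norm_cancel[OF assms]] by simp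
  then have "backward_limit s = suminf ?d"
    unfolding backward_limit_def by (rule limI)
  with * show "(\<lambda>n. backward n s) \<longlonglongrightarrow> backward_limit s" by simp
  have "norm (suminf ?d) \<le> (\<Sum>n. norm (?d n))"
    by (rule summable_norm[OF assms])
  then show "ennreal (norm (backward_limit s)) \<le> (\<Sum>n. ennreal (norm (?d n)))"
    using \<open>backward_limit s = suminf ?d\<close> assms by (simp add: suminf_ennreal2 ennreal_leI)
qed

lemma AE_backward_summable:
  "AE s in stream_space \<Gamma>. summable (\<lambda>n. norm (backward (Suc n) s - backward n s))"
proof -
  have "AE s in stream_space \<Gamma>. (\<Sum>n. ennreal (norm (backward (Suc n) s - backward n s))) \<noteq> \<infinity>"
    using nn_integral_backward_steps by (intro nn_integral_PInf_AE) auto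
  then show ?thesis
    by eventually_elim (auto intro: summable_suminf_not_top)
qed

text \<open>By the contraction and the two comparisons with the norm, each map is Lipschitz with
  constant \<open>c * r * C\<close>, so it may be exchanged with the limit.\<close>

lemma backward_limit_Stream:
  assumes "summable (\<lambda>n. norm (backward (Suc n) s - backward n s))"
  shows "backward_limit (\<omega> ## s) = F (backward_limit s) \<omega>"
proof -
  have "(\<lambda>n. F (backward n s) \<omega>) \<longlonglongrightarrow> F (backward_limit s) \<omega>"
  proof (rule LIM_zero_cancel, rule Lim_null_comparison)
    have "norm (F z \<omega> - F z' \<omega>) \<le> c * (r * (C * norm (z - z')))" for z z'
    proof -
      have "c * N (F z \<omega> - F z' \<omega>) \<le> c * (r * (C * norm (z - z')))"
        using r by (intro mult_left_mono[OF _ c] order_trans[OF contraction] mult_left_mono[OF N_le_norm]) auto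
      then show ?thesis using norm_le_N order_trans by blast
    qed
    then show "\<forall>\<^sub>F n in sequentially. norm (F (backward n s) \<omega> - F (backward_limit s) \<omega>)
        \<le> c * (r * (C * norm (backward n s - backward_limit s)))"
      by simp
    have "(\<lambda>n. backward n s - backward_limit s) \<longlonglongrightarrow> 0"
      using backward_converges(1)[OF assms] by (rule LIM_zero)
    then show "(\<lambda>n. c * (r * (C * norm (backward n s - backward_limit s)))) \<longlonglongrightarrow> 0"
      by (intro tendsto_mult_right_zero tendsto_norm_zero)
  qed
  then have "(\<lambda>n. backward (Suc n) (\<omega> ## s)) \<longlonglongrightarrow> F (backward_limit s) \<omega>"
    by simp
  then show ?thesis
    unfolding backward_limit_def[of "\<omega> ## s"] by (rule limI[OF LIMSEQ_imp_Suc])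
qed

text \<open>Prepending an independent noise to an i.i.d. stream gives a stream of the same law. On
  the limit this operation acts as one step of the chain.\<close>

lemma invariant_prob_stationary: "invariant_prob kernel stationary"
proof -
  interpret S: prob_space "stream_space \<Gamma>" by (rule prob_space_stream_space)
  interpret \<Gamma>S: pair_sigma_finite \<Gamma> "stream_space \<Gamma>" ..
  have stat: "stationary \<in> space (prob_algebra borel)"
    by (simp add: prob_algebra_borel_iff stationary_def S.prob_space_distr)
  have "stationary \<bind> kernel = stationary"
  proof (rule measure_eqI)
    show sets: "sets (stationary \<bind> kernel) = sets stationary"
      using bind_kernel_prob[OF stat] stat by (simp add: prob_algebra_borel_iff)
    fix A assume "A \<in> sets (stationary \<bind> kernel)"
    then have [measurable]: "A \<in> sets borel"
      using sets by (simp add: stationary_def)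
    have [measurable]: "(\<lambda>z. emeasure (kernel z) A) \<in> borel_measurable borel"
      by (rule measurable_compose[OF measurable_prob_algebraD[OF measurable_kernel]
            measurable_emeasure_subprob_algebra]) simp
    have "emeasure (stationary \<bind> kernel) A = (\<integral>\<^sup>+z. emeasure (kernel z) A \<partial>stationary)"
      by (rule emeasure_bind_prob_algebra[OF stat measurable_kernel]) simp
    also have "\<dots> = (\<integral>\<^sup>+s. emeasure (kernel (backward_limit s)) A \<partial>stream_space \<Gamma>)"
      unfolding stationary_def by (subst nn_integral_distr) auto
    also have "\<dots> = (\<integral>\<^sup>+s. (\<integral>\<^sup>+\<omega>. indicator A (F (backward_limit s) \<omega>) \<partial>\<Gamma>) \<partial>stream_space \<Gamma>)"
    proof (intro nn_integral_cong)
      fix s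
      have "(\<integral>\<^sup>+\<omega>. indicator A (F (backward_limit s) \<omega>) \<partial>\<Gamma>)
          = (\<integral>\<^sup>+z. indicator A z \<partial>kernel (backward_limit s))"
        unfolding kernel_def by (subst nn_integral_distr) auto
      then show "emeasure (kernel (backward_limit s)) A
          = (\<integral>\<^sup>+\<omega>. indicator A (F (backward_limit s) \<omega>) \<partial>\<Gamma>)"
        by (simp add: kernel_def)
    qed
    also have "\<dots> = (\<integral>\<^sup>+\<omega>. (\<integral>\<^sup>+s. indicator A (F (backward_limit s) \<omega>) \<partial>stream_space \<Gamma>) \<partial>\<Gamma>)"
      by (rule \<Gamma>S.Fubini') measurable
    also have "\<dots> = (\<integral>\<^sup>+\<omega>. (\<integral>\<^sup>+s. indicator A (backward_limit (\<omega> ## s)) \<partial>stream_space \<Gamma>) \<partial>\<Gamma>)"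
    proof (rule nn_integral_cong, rule nn_integral_cong_AE)
      fix \<omega>
      show "AE s in stream_space \<Gamma>. indicator A (F (backward_limit s) \<omega>)
          = (indicator A (backward_limit (\<omega> ## s)) :: ennreal)"
        using AE_backward_summable by eventually_elim (simp add: backward_limit_Stream)
    qed
    also have "\<dots> = (\<integral>\<^sup>+s. indicator A (backward_limit s) \<partial>stream_space \<Gamma>)"
      by (rule nn_integral_stream_space[symmetric]) measurable
    also have "\<dots> = (\<integral>\<^sup>+z. indicator A z \<partial>stationary)"
      unfolding stationary_def by (subst nn_integral_distr) auto
    also have "\<dots> = emeasure stationary A"
      by (simp add: stationary_def)
    finally show "emeasure (stationary \<bind> kernel) A = emeasure stationary A" .
  qed
  with stat show ?thesis
    by (simp add: invariant_prob_def prob_algebra_borel_iff)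
qed

lemma invariant_law_kernel: "invariant_law kernel = stationary"
  unfolding invariant_law_def
  by (rule the_equality) (auto intro: invariant_prob_stationary invariant_prob_unique)

text \<open>Needed to compare a Dirac mass with the invariant law by the linear bound: their product
  coupling must have finite mean distance.\<close>

lemma stationary_first_moment: "(\<integral>\<^sup>+z. ennreal (norm z) \<partial>stationary) < \<infinity>"
proof -
  have "(\<integral>\<^sup>+z. ennreal (norm z) \<partial>stationary) = (\<integral>\<^sup>+s. ennreal (norm (backward_limit s)) \<partial>stream_space \<Gamma>)"
    unfolding stationary_def by (subst nn_integral_distr) auto
  also have "\<dots> \<le> (\<integral>\<^sup>+s. (\<Sum>n. ennreal (norm (backward (Suc n) s - backward n s))) \<partial>stream_space \<Gamma>)"
  proof (rule nn_integral_mono_AE)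
    show "AE s in stream_space \<Gamma>. ennreal (norm (backward_limit s))
        \<le> (\<Sum>n. ennreal (norm (backward (Suc n) s - backward n s)))"
      using AE_backward_summable by eventually_elim (rule backward_converges(2))
  qed
  finally show ?thesis
    using nn_integral_backward_steps by (rule le_less_trans)
qed

lemma tv_convergence_rate_le: "tv_convergence_rate kernel \<le> ereal r"
proof -
  have stat: "stationary \<in> space (prob_algebra borel)"
    using invariant_prob_stationary by (simp add: prob_algebra_borel_iff invariant_prob_def)
  have "limsup (\<lambda>n. ln_ennreal (tv_dist (law_after kernel (return borel z) n) stationary) / ereal (real n))
      \<le> ereal (ln r)" for z
  proof -
    have z: "return borel z \<in> space (prob_algebra borel)"
      by (simp add: prob_algebra_borel_iff prob_space_return)
    let ?\<rho> = "return borel z \<Otimes>\<^sub>M stationary"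
    note \<rho> = pair_measure_couplings[OF z stat]
    have [measurable_cong]: "sets ?\<rho> = sets borel" using z stat \<rho> by (rule sets_coupling)
    have "(\<integral>\<^sup>+p. ennreal (norm (fst p - snd p)) \<partial>?\<rho>)
        \<le> (\<integral>\<^sup>+p. ennreal (norm (fst p)) + ennreal (norm (snd p)) \<partial>?\<rho>)"
      by (intro nn_integral_mono) (simp flip: ennreal_plus add: norm_triangle_ineq4)
    also have "\<dots> = (\<integral>\<^sup>+p. ennreal (norm (fst p)) \<partial>?\<rho>) + (\<integral>\<^sup>+p. ennreal (norm (snd p)) \<partial>?\<rho>)"
      by (intro nn_integral_add) measurable
    also have "\<dots> = (\<integral>\<^sup>+x. ennreal (norm x) \<partial>return borel z) + (\<integral>\<^sup>+x. ennreal (norm x) \<partial>stationary)"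
      by (simp only: nn_integral_coupling[OF z stat \<rho>, of "\<lambda>x. ennreal (norm x)"] borel_measurable_norm
          measurable_compose[OF borel_measurable_norm measurable_ennreal])
    also have "\<dots> < \<infinity>"
      using stationary_first_moment by (simp add: nn_integral_return)
    finally obtain a where a: "(\<integral>\<^sup>+p. ennreal (norm (fst p - snd p)) \<partial>?\<rho>) = ennreal a" "0 \<le> a"
      by (cases "\<integral>\<^sup>+p. ennreal (norm (fst p - snd p)) \<partial>?\<rho>") auto
    \<comment> \<open>The division by \<open>r\<close> absorbs the step lost to regularization; the
      summand 1 keeps \<open>B\<close> positive, so that its logarithm is legitimate even when
      \<open>a = 0\<close>.\<close>
    define B where "B = 2 * q * C * a / r + 1"
    have B: "0 < B" using q C a r by (auto simp: B_def intro!: add_nonneg_pos)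
    have tv: "tv_dist (law_after kernel (return borel z) (Suc n)) stationary \<le> ennreal (B * r ^ Suc n)" for n
    proof -
      have "tv_dist (law_after kernel (return borel z) (Suc n)) stationary
          \<le> ennreal (2 * q * C * r ^ n) * ennreal a"
        using tv_dist_law_after_le_norm[OF z stat \<rho>, of n]
        by (simp add: law_after_invariant[OF invariant_prob_stationary] a)
      also have "\<dots> = ennreal (2 * q * C * r ^ n * a)"
        using a by (intro ennreal_mult''[symmetric])
      also have "\<dots> \<le> ennreal (B * r ^ Suc n)"
        using r by (intro ennreal_leI) (simp add: B_def distrib_right)
      finally show ?thesis .
    qed
    have bound: "ln_ennreal (tv_dist (law_after kernel (return borel z) n) stationary) / ereal (real n)
        \<le> ereal (ln B / real n + ln r)" if n: "0 < n" for n
    proof -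
      obtain n' where n': "n = Suc n'" using n by (cases n) auto
      have "ln_ennreal (tv_dist (law_after kernel (return borel z) n) stationary) \<le> ereal (ln (B * r ^ n))"
        unfolding n' using tv B r by (intro ln_ennreal_le) auto
      then have "ln_ennreal (tv_dist (law_after kernel (return borel z) n) stationary) / ereal (real n)
          \<le> ereal (ln (B * r ^ n)) / ereal (real n)"
        using n by (intro ereal_divide_right_mono) auto
      also have "\<dots> = ereal (ln B / real n + ln r)"
        using B r n by (simp add: ln_mult ln_realpow add_divide_distrib)
      finally show ?thesis .
    qed
    have "limsup (\<lambda>n. ln_ennreal (tv_dist (law_after kernel (return borel z) n) stationary) / ereal (real n))
        \<le> limsup (\<lambda>n. ereal (ln B / real n + ln r))"
      using bound by (intro Limsup_mono eventually_mono[OF eventually_gt_at_top[of 0]])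
    also have "(\<lambda>n. ereal (ln B / real n + ln r)) \<longlonglongrightarrow> ereal (0 + ln r)"
      by (intro tendsto_intros lim_const_over_n)
    then have "limsup (\<lambda>n. ereal (ln B / real n + ln r)) = ereal (ln r)"
      by (intro lim_imp_Limsup) auto
    finally show ?thesis .
  qed
  then show ?thesis
    unfolding tv_convergence_rate_def invariant_law_kernel
    using r by (intro exp_ereal_le SUP_least) auto
qed

lemma tv_dist_le_wasserstein1:
  assumes \<nu>: "\<nu> \<in> space (prob_algebra borel)" and \<mu>: "\<mu> \<in> space (prob_algebra borel)"
  shows "tv_dist (law_after kernel \<nu> (Suc n)) (law_after kernel \<mu> (Suc n))
    \<le> ennreal (2 * q * C * r ^ n) * wasserstein1 \<nu> \<mu>"
proof -
  let ?t = "tv_dist (law_after kernel \<nu> (Suc n)) (law_after kernel \<mu> (Suc n))"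
  let ?K = "ennreal (2 * q * C * r ^ n)"
  have *: "?t \<le> ?K * (\<integral>\<^sup>+p. ennreal (dist (fst p) (snd p)) \<partial>\<rho>)" if "\<rho> \<in> couplings \<nu> \<mu>" for \<rho>
    using tv_dist_law_after_le_norm[OF \<nu> \<mu> that] by (simp add: dist_norm)
  show ?thesis
  \<comment> \<open>The constant is pulled out of the infimum by dividing by it. If it vanishes, the
    bound for a single coupling is already 0.\<close>
  proof (cases "?K = 0")
    case True
    then show ?thesis
      using *[OF pair_measure_couplings[OF \<nu> \<mu>]] by simp
  next
    case False
    have "?t / ?K \<le> wasserstein1 \<nu> \<mu>"
      unfolding wasserstein1_def
      using False by (intro INF_greatest divide_le_posI_ennreal *) (auto simp: zero_less_iff_neq_zero)
    then have "?t / ?K * ?K \<le> wasserstein1 \<nu> \<mu> * ?K"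
      by (rule mult_right_mono) simp
    also have "?t / ?K * ?K = ?t"
      using False by (simp add: ennreal_divide_times)
    finally show ?thesis by (simp add: mult.commute)
  qed
qed

end

section \<open>Convergence of the OBABO chain\<close>

context obabo
begin

lemma borel_measurable_grad [measurable]: "grad U \<in> borel_measurable borel"
proof (rule borel_measurable_continuous_onI)
  have "L-lipschitz_on UNIV (grad U)"
    using L lipschitz by (intro lipschitz_onI) (auto simp: dist_norm)
  then show "continuous_on UNIV (grad U)"
    by (rule lipschitz_on_continuous_on)
qed

lemma measurable_step:
  assumes [measurable]: "f \<in> borel_measurable M" "h \<in> borel_measurable M"
  shows "(\<lambda>x. F (f x) (h x)) \<in> borel_measurable M"
proof -
  have [measurable]: "(\<lambda>x. fst (f x)) \<in> borel_measurable M" "(\<lambda>x. snd (f x)) \<in> borel_measurable M"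
    "(\<lambda>x. fst (h x)) \<in> borel_measurable M" "(\<lambda>x. snd (h x)) \<in> borel_measurable M"
    by (auto intro: measurable_compose[OF _ borel_measurable_fst_snd(1)]
        measurable_compose[OF _ borel_measurable_fst_snd(2)])
  show ?thesis
    unfolding obabo_step_def Let_def split_beta'
    by (intro borel_measurable_Pair) measurable
qed

text \<open>Reduces the first moment of one step from \<open>0\<close> to that of the Gaussian
  norm.\<close>

lemma step_affine_growth: "\<exists>A B. 0 \<le> A \<and> 0 \<le> B \<and> (\<forall>\<omega>. norm (F 0 \<omega>) \<le> A + B * norm \<omega>)"
proof -
  let ?a = "norm (grad U 0)"
  let ?A = "\<delta>\<^sup>2 / 2 * ?a" and ?B = "\<delta> * \<sigma>"
  let ?M = "\<delta> * \<eta> / 2"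
  have "norm (F 0 \<omega>) \<le> (?A + ?M * (2 * ?a + L * ?A)) + (?B + ?M * (L * ?B) + \<sigma> * (\<eta> + 1)) * norm \<omega>" for \<omega>
  proof -
    obtain g h where \<omega>: "\<omega> = (g, h)" by (cases \<omega>)
    have gh: "norm g \<le> norm \<omega>" "norm h \<le> norm \<omega>"
      unfolding \<omega> by (auto intro: norm_fst_le norm_snd_le)
    let ?x = "fst (F (0, 0) (g, h))"
    have "norm ?x \<le> norm ((\<delta> * \<sigma>) *\<^sub>R g) + norm ((\<delta>\<^sup>2 / 2) *\<^sub>R grad U 0)"
      unfolding step_fst using norm_triangle_ineq4[of "(\<delta> * \<sigma>) *\<^sub>R g" "(\<delta>\<^sup>2 / 2) *\<^sub>R grad U 0"] by simp
    also have "\<dots> = ?B * norm g + ?A"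
      using \<delta> \<sigma> by simp
    also have "\<dots> \<le> ?B * norm \<omega> + ?A"
      using \<delta> \<sigma> gh by (intro add_right_mono mult_left_mono) auto
    finally have x: "norm ?x \<le> ?A + ?B * norm \<omega>" by simp
    have "norm (grad U ?x) \<le> ?a + norm (grad U ?x - grad U 0)"
      by (rule norm_triangle_sub)
    also have "norm (grad U ?x - grad U 0) \<le> L * norm (?x - 0)"
      by (rule lipschitz)
    also have "\<dots> \<le> L * (?A + ?B * norm \<omega>)"
      using x L by (intro mult_left_mono) auto
    finally have g: "norm (grad U 0 + grad U ?x) \<le> 2 * ?a + L * (?A + ?B * norm \<omega>)"
      using norm_triangle_ineq[of "grad U 0" "grad U ?x"] by simp
    have "norm (snd (F (0, 0) (g, h))) \<le> norm (?M *\<^sub>R (grad U 0 + grad U ?x)) + norm (\<sigma> *\<^sub>R (\<eta> *\<^sub>R g + h))"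
      unfolding step_snd using norm_triangle_ineq[of "- (?M *\<^sub>R (grad U 0 + grad U ?x))" "\<sigma> *\<^sub>R (\<eta> *\<^sub>R g + h)"]
      by (simp del: scaleR_add_right)
    also have "\<dots> = ?M * norm (grad U 0 + grad U ?x) + \<sigma> * norm (\<eta> *\<^sub>R g + h)"
      using \<delta> \<eta> \<sigma> by simp
    also have "\<dots> \<le> ?M * (2 * ?a + L * (?A + ?B * norm \<omega>)) + \<sigma> * (\<eta> * norm \<omega> + norm \<omega>)"
    proof (intro add_mono mult_left_mono g)
      show "norm (\<eta> *\<^sub>R g + h) \<le> \<eta> * norm \<omega> + norm \<omega>"
        using \<eta> gh by (intro order_trans[OF norm_triangle_ineq] add_mono) auto
    qed (use \<delta> \<eta> \<sigma> in auto)
    finally have v: "norm (snd (F (0, 0) (g, h))) \<le> \<dots>" .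
    have "norm (F 0 \<omega>) \<le> norm ?x + norm (snd (F (0, 0) (g, h)))"
      unfolding \<omega> zero_prod_def by (metis norm_Pair_le prod.collapse)
    also have "\<dots> \<le> (?A + ?B * norm \<omega>) + (?M * (2 * ?a + L * (?A + ?B * norm \<omega>)) + \<sigma> * (\<eta> * norm \<omega> + norm \<omega>))"
      using x v by (rule add_mono)
    also have "\<dots> = (?A + ?M * (2 * ?a + L * ?A)) + (?B + ?M * (L * ?B) + \<sigma> * (\<eta> + 1)) * norm \<omega>"
      by (simp only: distrib_left distrib_right mult.assoc mult_1 mult_1_right add_ac)
    finally show ?thesis .
  qed
  moreover have "0 \<le> ?A + ?M * (2 * ?a + L * ?A)" "0 \<le> ?B + ?M * (L * ?B) + \<sigma> * (\<eta> + 1)"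
    using \<delta> \<eta> \<sigma> L by auto
  ultimately show ?thesis by blast
qed

sublocale random_map std_gaussian F
proof (intro random_map.intro prob_space_std_gaussian random_map_axioms.intro)
  show "(\<lambda>(z, \<omega>). F z \<omega>) \<in> borel \<Otimes>\<^sub>M std_gaussian \<rightarrow>\<^sub>M borel"
    unfolding split_beta' by (intro measurable_step) measurable
qed

lemma kernel_eq: "obabo_kernel U \<delta> \<gamma> = kernel"
  by (simp add: fun_eq_iff obabo_kernel_def kernel_def std_gaussian_pair)

text \<open>The coefficient of \<open>norm_shift_le\<close> divided by \<open>sqrt (2 * pi)\<close>:
  a bound on the rejection probability per unit of \<open>lyap\<close>.\<close>

definition q :: real where "q = sqrt 2 * (18 / 17) / (\<delta> * \<sigma>) / sqrt (2 * pi)"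

text \<open>The first chain uses the noise \<open>g\<close>, the second one \<open>g\<close>
  translated by the shift or reflected. For a fixed pair of starting points the shift is
  deterministic, so the second noise is again Gaussian. On acceptance the chains meet by
  \<open>step_shift\<close>, so the disagreement is at most the rejection probability.\<close>

lemma one_step_tv_dist:
  assumes \<nu>: "\<nu> \<in> space (prob_algebra borel)" and \<mu>: "\<mu> \<in> space (prob_algebra borel)"
    and \<rho>: "\<rho> \<in> couplings \<nu> \<mu>"
  shows "tv_dist (\<nu> \<bind> kernel) (\<mu> \<bind> kernel) \<le> (\<integral>\<^sup>+p. 2 * ennreal (min 1 (q * lyap (fst p - snd p))) \<partial>\<rho>)"
proof -
  interpret u: prob_space uniform01 by (rule prob_space_uniform01)
  interpret \<rho>: prob_space \<rho> using assms by (rule prob_space_coupling)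
  let ?\<Omega> = "std_gaussian \<Otimes>\<^sub>M uniform01 :: (('a \<times> 'a) \<times> real) measure"
  interpret \<Omega>: pair_prob_space "std_gaussian :: ('a \<times> 'a) measure" uniform01 ..
  have [measurable_cong]: "sets \<rho> = sets borel" using assms by (rule sets_coupling)
  let ?h = "\<lambda>p. shift (fst p) (snd p)"
  let ?T = "\<lambda>p. translate_or_reflect (?h p)"
  let ?\<Phi> = "\<lambda>p \<omega>. F (fst p) (fst \<omega>)" and ?\<Psi> = "\<lambda>p \<omega>. F (snd p) (?T p \<omega>)"
  have [measurable]: "?h \<in> borel_measurable borel"
  proof -
    have "?h = (\<lambda>p. (1 / (\<delta> * \<sigma>)) *\<^sub>R (fst (F (fst p) 0 - F (snd p) 0), - \<eta> *\<^sub>R fst (fst p - snd p)))"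
      by (simp add: shift_def fun_eq_iff)
    also have "\<dots> \<in> borel_measurable borel"
      by (intro borel_measurable_scaleR borel_measurable_Pair measurable_compose[OF _ borel_measurable_fst_snd(1)]
          borel_measurable_diff measurable_step borel_measurable_fst_snd measurable_const) auto
    finally show ?thesis .
  qed
  have T [measurable]: "(\<lambda>x. ?T (fst x) (snd x)) \<in> borel \<Otimes>\<^sub>M ?\<Omega> \<rightarrow>\<^sub>M borel"
    unfolding translate_or_reflect_def split_beta' by measurable
  have \<Phi> [measurable]: "(\<lambda>(p, \<omega>). ?\<Phi> p \<omega>) \<in> borel \<Otimes>\<^sub>M ?\<Omega> \<rightarrow>\<^sub>M borel"
    and \<Psi> [measurable]: "(\<lambda>(p, \<omega>). ?\<Psi> p \<omega>) \<in> borel \<Otimes>\<^sub>M ?\<Omega> \<rightarrow>\<^sub>M borel"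
    unfolding split_beta' by (intro measurable_step; measurable)+
  have \<Phi>d: "distr ?\<Omega> borel (?\<Phi> p) = kernel (fst p)" for p
  proof -
    have "distr ?\<Omega> borel (?\<Phi> p) = distr (distr ?\<Omega> std_gaussian fst) borel (F (fst p))"
      by (subst distr_distr) (auto simp: comp_def)
    then show ?thesis
      by (simp add: u.distr_pair_fst kernel_def)
  qed
  have \<Psi>d: "distr ?\<Omega> borel (?\<Psi> p) = kernel (snd p)" for p
  proof -
    have [measurable]: "?T p \<in> ?\<Omega> \<rightarrow>\<^sub>M borel"
      unfolding translate_or_reflect_def by measurable
    have [measurable]: "F (snd p) \<in> borel \<rightarrow>\<^sub>M borel"
      by (intro measurable_step) measurable
    have "distr ?\<Omega> borel (?\<Psi> p) = distr (distr ?\<Omega> borel (?T p)) borel (F (snd p))"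
      by (subst distr_distr) (auto simp: comp_def)
    then show ?thesis
      by (simp add: distr_translate_or_reflect kernel_def)
  qed
  let ?\<rho> = "distr (\<rho> \<Otimes>\<^sub>M ?\<Omega>) borel (\<lambda>(p, \<omega>). (?\<Phi> p \<omega>, ?\<Psi> p \<omega>))"
  have "?\<rho> \<in> couplings (\<nu> \<bind> kernel) (\<mu> \<bind> kernel)"
    using \<nu> \<mu> \<rho> \<Omega>.P.prob_space_axioms measurable_kernel \<Phi> \<Psi> \<Phi>d \<Psi>d by (rule coupling_step)
  then have "tv_dist (\<nu> \<bind> kernel) (\<mu> \<bind> kernel) \<le> 2 * emeasure ?\<rho> {p \<in> space ?\<rho>. fst p \<noteq> snd p}"
    unfolding tv_dist_def by (rule INF_lower)
  also have "emeasure ?\<rho> {p \<in> space ?\<rho>. fst p \<noteq> snd p} \<le> (\<integral>\<^sup>+p. ennreal (min 1 (q * lyap (fst p - snd p))) \<partial>\<rho>)"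
  proof -
    let ?N = "{p. fst p \<noteq> snd p} :: (('a \<times> 'a) \<times> ('a \<times> 'a)) set"
    have [measurable]: "?N \<in> sets borel" by measurable
    have "emeasure ?\<rho> {p \<in> space ?\<rho>. fst p \<noteq> snd p} = (\<integral>\<^sup>+p. indicator ?N p \<partial>?\<rho>)"
      by simp
    also have "\<dots> = (\<integral>\<^sup>+x. indicator ?N (?\<Phi> (fst x) (snd x), ?\<Psi> (fst x) (snd x)) \<partial>(\<rho> \<Otimes>\<^sub>M ?\<Omega>))"
      by (subst nn_integral_distr) (auto simp: split_beta')
    also have "\<dots> \<le> (\<integral>\<^sup>+x. (if snd (snd x) \<le> accept (?h (fst x)) (fst (snd x)) then 0 else 1) \<partial>(\<rho> \<Otimes>\<^sub>M ?\<Omega>))"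
    proof (intro nn_integral_mono)
      fix x :: "(('a \<times> 'a) \<times> ('a \<times> 'a)) \<times> (('a \<times> 'a) \<times> real)"
      have "?\<Phi> (fst x) (snd x) = ?\<Psi> (fst x) (snd x)"
        if "snd (snd x) \<le> accept (?h (fst x)) (fst (snd x))"
        using that by (simp add: translate_or_reflect_def split_beta' step_shift)
      then show "indicator ?N (?\<Phi> (fst x) (snd x), ?\<Psi> (fst x) (snd x))
          \<le> (if snd (snd x) \<le> accept (?h (fst x)) (fst (snd x)) then 0 else 1 :: ennreal)"
        by (auto simp: indicator_def)
    qed
    also have "\<dots> = (\<integral>\<^sup>+p. (\<integral>\<^sup>+\<omega>. (if snd \<omega> \<le> accept (?h p) (fst \<omega>) then 0 else 1) \<partial>?\<Omega>) \<partial>\<rho>)"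
      by (subst \<Omega>.P.nn_integral_fst[symmetric]) auto
    also have "\<dots> = (\<integral>\<^sup>+p. (\<integral>\<^sup>+g. (\<integral>\<^sup>+u. (if u \<le> accept (?h p) g then 0 else 1) \<partial>uniform01) \<partial>std_gaussian) \<partial>\<rho>)"
      by (intro nn_integral_cong, subst u.nn_integral_fst[symmetric]) auto
    also have "\<dots> = (\<integral>\<^sup>+p. (\<integral>\<^sup>+g. ennreal (1 - accept (?h p) g) \<partial>std_gaussian) \<partial>\<rho>)"
      by (simp add: nn_integral_uniform01_if accept)
    also have "\<dots> \<le> (\<integral>\<^sup>+p. ennreal (min 1 (q * lyap (fst p - snd p))) \<partial>\<rho>)"
    proof (intro nn_integral_mono order_trans[OF nn_integral_rejection_le] ennreal_leI min.mono order_refl)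
      fix p :: "('a \<times> 'a) \<times> ('a \<times> 'a)"
      have "norm (?h p) / sqrt (2 * pi) \<le> sqrt 2 * (18 / 17) / (\<delta> * \<sigma>) * lyap (fst p - snd p) / sqrt (2 * pi)"
        by (intro divide_right_mono norm_shift_le) simp
      then show "norm (?h p) / sqrt (2 * pi) \<le> q * lyap (fst p - snd p)"
        by (simp add: q_def)
    qed
    finally show ?thesis .
  qed
  also have "2 * (\<integral>\<^sup>+p. ennreal (min 1 (q * lyap (fst p - snd p))) \<partial>\<rho>)
      = (\<integral>\<^sup>+p. 2 * ennreal (min 1 (q * lyap (fst p - snd p))) \<partial>\<rho>)"
    unfolding lyap_def by (intro nn_integral_cmult[symmetric]) measurable
  finally show ?thesis
    by (simp add: mult_left_mono)
qed

sublocale contracting_random_map std_gaussian F lyap "sqrt (1 - k)" "18 / 17 + 1 / \<beta>"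
  "sqrt (4 / 3) * max (sqrt L) (1 / sqrt L)" q
proof
  show "lyap \<in> borel_measurable borel"
    unfolding lyap_def[abs_def] by measurable
  show "0 < sqrt (1 - k)" "sqrt (1 - k) < 1"
    using k by auto
  show "0 \<le> 18 / 17 + 1 / \<beta>" "0 \<le> sqrt (4 / 3) * max (sqrt L) (1 / sqrt L)" "0 \<le> q"
    using \<beta> L \<delta> \<sigma> by (auto simp: q_def le_max_iff_disj)
  show "(\<integral>\<^sup>+\<omega>. ennreal (norm (F 0 \<omega>)) \<partial>std_gaussian) < \<infinity>"
  proof -
    obtain A B where AB: "0 \<le> A" "0 \<le> B" "\<And>\<omega>. norm (F 0 \<omega>) \<le> A + B * norm \<omega>"
      using step_affine_growth by blast
    have "(\<integral>\<^sup>+\<omega>. ennreal (norm (F 0 \<omega>)) \<partial>std_gaussian)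
        \<le> (\<integral>\<^sup>+\<omega>. ennreal A + ennreal B * ennreal (norm \<omega>) \<partial>(std_gaussian :: ('a \<times> 'a) measure))"
      using AB by (intro nn_integral_mono) (simp flip: ennreal_mult ennreal_plus)
    also have "\<dots> = ennreal A + ennreal B * (\<integral>\<^sup>+\<omega>. ennreal (norm \<omega>) \<partial>(std_gaussian :: ('a \<times> 'a) measure))"
      by (subst nn_integral_add, simp, simp, subst nn_integral_cmult)
        (auto simp: prob_space.emeasure_space_1[OF prob_space_std_gaussian, simplified])
    also have "\<dots> < \<infinity>"
      using nn_integral_std_gaussian_norm[where 'a = "'a \<times> 'a"] by (simp add: ennreal_mult_less_top)
    finally show ?thesis .
  qed
qed (fact lyap_nonneg norm_le_lyap lyap_le_norm lyap_step one_step_tv_dist)+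

text \<open>The factor \<open>sqrt \<delta>\<close> in \<open>K\<^sub>2\<close> cancels against
  \<open>\<delta> powr (3 / 2)\<close>, leaving \<open>1 / (\<delta> \<sigma> sqrt (2\<pi>))\<close>
  on both sides. From the maximum in \<open>K\<^sub>2\<close> only the bound 2 is taken.\<close>

lemma constant_le:
  "2 * q * (sqrt (4 / 3) * max (sqrt L) (1 / sqrt L)) * sqrt (1 - k) ^ n
    \<le> (sqrt 3 * max (L powr (1 / 2)) (L powr (- 1 / 2)))
      * (sqrt (\<delta> / (2 * pi * (1 - (obabo_eta \<delta> \<gamma>)\<^sup>2))) * max (2 + 3 * \<delta>\<^sup>2 * L / 2) (3 * \<delta>))
      / \<delta> powr (3 / 2) * (1 - k) powr ((real (Suc n) - 1) / 2)"
proof -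
  let ?M = "max (sqrt L) (1 / sqrt L)" and ?T = "max (2 + 3 * \<delta>\<^sup>2 * L / 2) (3 * \<delta>)"
  let ?D = "\<delta> * \<sigma> * sqrt (2 * pi)"
  have M: "max (L powr (1 / 2)) (L powr (- 1 / 2)) = ?M" "0 \<le> ?M"
    using L by (auto simp: powr_half_sqrt powr_minus_divide le_max_iff_disj)
  \<comment> \<open>The three losses together: the weight of the position, the two components of the
    shift, and the comparison of \<open>lyap\<close> with the norm. The radicand is
    \<open>2592 / 867 < 3\<close>.\<close>
  have "18 / 17 * (sqrt 2 * sqrt (4 / 3)) = sqrt ((18 / 17)\<^sup>2 * (2 * (4 / 3)))"
    by (simp only: real_sqrt_mult real_sqrt_abs)
  also have "\<dots> \<le> sqrt 3"
    by (intro real_sqrt_le_mono) (simp add: power2_eq_square)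
  finally have "18 / 17 * (sqrt 2 * sqrt (4 / 3)) * 2 \<le> sqrt 3 * ?T"
    using \<delta> L by (intro mult_mono) (auto simp: le_max_iff_disj)
  then have "18 / 17 * (sqrt 2 * sqrt (4 / 3)) * 2 * ?M / ?D \<le> sqrt 3 * ?T * ?M / ?D"
    using M \<delta> \<sigma> by (intro divide_right_mono mult_right_mono) auto
  then have "2 * q * (sqrt (4 / 3) * ?M) \<le> sqrt 3 * ?T * ?M / ?D"
    by (simp add: q_def mult_ac)
  also have "\<dots> = (sqrt 3 * ?M) * (sqrt (\<delta> / (2 * pi * \<sigma>\<^sup>2)) * ?T) / \<delta> powr (3 / 2)"
  proof -
    have "\<delta> powr (3 / 2) = \<delta> powr (1 + 1 / 2)" by simp
    also have "\<dots> = \<delta> * sqrt \<delta>"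
      using \<delta> by (subst powr_add) (simp add: powr_half_sqrt)
    finally have "\<delta> powr (3 / 2) = \<delta> * sqrt \<delta>" .
    then show ?thesis
      using \<delta> \<sigma>(1) by (simp add: real_sqrt_divide real_sqrt_mult mult_ac)
  qed
  finally have "2 * q * (sqrt (4 / 3) * ?M) \<le> \<dots>" .
  moreover have "sqrt (1 - k) ^ n = (1 - k) powr ((real (Suc n) - 1) / 2)"
  proof -
    have "sqrt (1 - k) ^ n = ((1 - k) powr (1 / 2)) powr real n"
      using k by (simp add: powr_half_sqrt powr_realpow)
    then show ?thesis by (simp add: powr_powr)
  qed
  ultimately show ?thesis
    unfolding M(1) \<sigma>(2) \<eta>_def by (simp only: mult_right_mono[OF _ powr_ge_zero])
qed

end

theorem corollary5:
  fixes U :: "real ^ 'n \<Rightarrow> real" and m L \<gamma> \<delta> :: real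
  defines "\<kappa> \<equiv> m / (3 * \<gamma>)"
    and "K\<^sub>1 \<equiv> sqrt 3 * max (L powr (1 / 2)) (L powr (- 1 / 2))"
    and "K\<^sub>2 \<equiv> sqrt (\<delta> / (2 * pi * (1 - (obabo_eta \<delta> \<gamma>)\<^sup>2))) * max (2 + 3 * \<delta>\<^sup>2 * L / 2) (3 * \<delta>)"
    and "P \<equiv> obabo_kernel U \<delta> \<gamma>"
  assumes "C2 U"
    and "0 < m" and "m \<le> L"
    and "\<And>x y. norm (grad U x - grad U y) \<le> L * norm (x - y)"
    and "\<And>x y. (x - y) \<bullet> (grad U x - grad U y) \<ge> m * (norm (x - y))\<^sup>2"
    and "\<gamma> \<ge> 2 * sqrt L"
    and "0 < \<delta>" and "\<delta> \<le> m / (33 * \<gamma> ^ 3)"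
  shows "(\<forall>\<nu>\<in>prob_measures1. \<forall>\<mu>\<in>prob_measures1. \<forall>n::nat. n \<ge> 1 \<longrightarrow>
            tv_dist (law_after P \<nu> n) (law_after P \<mu> n)
              \<le> ennreal (K\<^sub>1 * K\<^sub>2 / \<delta> powr (3 / 2) * (1 - \<delta> * \<kappa>) powr ((real n - 1) / 2))
                  * wasserstein1 \<nu> \<mu>) \<and>
         tv_convergence_rate P \<le> ereal (1 - \<delta> * \<kappa> / 2)"
proof -
  interpret obabo U m L \<gamma> \<delta>
    by standard (fact assms)+
  have k: "\<delta> * \<kappa> = k" by (simp add: k_def \<kappa>_def)
  have P: "P = kernel" unfolding P_def by (rule kernel_eq)
  show ?thesis
  proof (intro conjI ballI allI impI)
    fix \<nu> \<mu> :: "((real ^ 'n) \<times> (real ^ 'n)) measure" and n :: nat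
    assume "\<nu> \<in> prob_measures1" "\<mu> \<in> prob_measures1" "1 \<le> n"
    then obtain n' where n: "n = Suc n'"
      and "\<nu> \<in> space (prob_algebra borel)" "\<mu> \<in> space (prob_algebra borel)"
      by (cases n) (auto simp: prob_measures1_def prob_algebra_borel_iff)
    then have "tv_dist (law_after P \<nu> n) (law_after P \<mu> n)
        \<le> ennreal (2 * q * (sqrt (4 / 3) * max (sqrt L) (1 / sqrt L)) * sqrt (1 - k) ^ n') * wasserstein1 \<nu> \<mu>"
      unfolding P n by (intro tv_dist_le_wasserstein1)
    also have "\<dots> \<le> ennreal (K\<^sub>1 * K\<^sub>2 / \<delta> powr (3 / 2) * (1 - \<delta> * \<kappa>) powr ((real n - 1) / 2)) * wasserstein1 \<nu> \<mu>"
      unfolding k n K\<^sub>1_def K\<^sub>2_def by (intro mult_right_mono ennreal_leI constant_le) simp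
    finally show "tv_dist (law_after P \<nu> n) (law_after P \<mu> n)
        \<le> ennreal (K\<^sub>1 * K\<^sub>2 / \<delta> powr (3 / 2) * (1 - \<delta> * \<kappa>) powr ((real n - 1) / 2)) * wasserstein1 \<nu> \<mu>" .
  next
    \<comment> \<open>The chain actually converges at rate \<open>sqrt (1 - k)\<close>; the claim is
      its tangent bound at \<open>k = 0\<close>.\<close>
    have "sqrt (1 - k) \<le> 1 - k / 2"
      using obabo.k[OF obabo_axioms] by (intro real_le_lsqrt) (auto simp: power2_eq_square algebra_simps)
    then show "tv_convergence_rate P \<le> ereal (1 - \<delta> * \<kappa> / 2)"
      using tv_convergence_rate_le unfolding P k by (metis ereal_less_eq(3) order_trans)
  qed
qed

end
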